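(* Let $\mathcal{B}$ be a unital AF C*-algebra with canonical diagonal $\mathcal{D}$ and let $\mathcal{A}$ be a norm-closed triangular subalgebra of $\mathcal{B}$ with diagonal $\mathcal{D}$ (i.e., $\mathcal{D} \subseteq \mathcal{A}$ and $\mathcal{A} \cap \mathcal{A}^* = \mathcal{D}$). Let $S = \operatorname{spec}(\mathcal{A}) \setminus \operatorname{spec}(\mathcal{D})$. If $\mathcal{L}$ is a norm-closed Lie ideal in $\mathcal{A}$, then $\mathcal{L} = \mathcal{F} + \mathcal{K}$, where $\mathcal{K}$ is a diagonal disjoint associative ideal in $\mathcal{A}$ (i.e. $\mathcal{K} \cap \mathcal{D} = \{0\}$) and, with $K = \operatorname{spec}(\mathcal{K})$, $\mathcal{F}$ is a linear subspace of $$\mathcal{E}_{\mathcal{K}} = \{f \in \mathcal{D} \mid f(x,x) = f(y,y) \text{ whenever } (x,y) \in S \setminus K\}.$$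
   Context: A Lie ideal in an algebra $\mathcal{A}$ is a linear subspace $\mathcal{L} \subseteq \mathcal{A}$ with $xa - ax \in \mathcal{L}$ for all $x \in \mathcal{L}$, $a \in \mathcal{A}$. An associative ideal is an ordinary two-sided ideal. Canonical diagonal: there is an increasing sequence $(\mathcal{B}_n)$ of finite dimensional C*-subalgebras of $\mathcal{B}$, each containing the unit of $\mathcal{B}$, with $\overline{\bigcup_n \mathcal{B}_n} = \mathcal{B}$, and for each $n$ a system of matrix units $\{e^n_{ij}\}$ for $\mathcal{B}_n$, such that each matrix unit of $\mathcal{B}_n$ is a sum of matrix units of $\mathcal{B}_{n+1}$; $\mathcal{D}_n$ is the masa of $\mathcal{B}_n$ spanned by the diagonal matrix units, and $\mathcal{D} = \overline{\bigcup_n \mathcal{D}_n}$. Coordinates: let $X$ be the (compact, totally disconnected) Gelfand spectrum of $\mathcal{D}$, so $\mathcal{D} \cong C(X)$. Each matrix unit $e$ of some $\mathcal{B}_n$ satisfies $e^*\mathcal{D}e \subseteq \mathcal{D}$ and $e\mathcal{D}e^* \subseteq \mathcal{D}$ and induces a homeomorphism $\alpha_e$ from $\{y \in X : (e^*e)(y) = 1\}$ onto $\{x \in X : (ee^* )(x) = 1\}$ by $d(\alpha_e(y)) = (e^*de)(y)$ for $d \in \mathcal{D}$; its graph is $\{(\alpha_e(y),y)\} \subseteq X \times X$. The groupoid $G \subseteq X \times X$ is the union of the graphs of all matrix units; it is an equivalence relation on $X$, topologized so that each such graph is open. For $f \in \mathcal{B}$, $\pi(f) = \lim_n \sum_i e^n_{ii}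 f e^n_{ii}$ defines the contractive conditional expectation of $\mathcal{B}$ onto $\mathcal{D}$, and $f$ is identified with the function on $G$ given by $f(x,y) = \pi(fe^* )(x)$ for any matrix unit $e$ whose graph contains $(x,y)$. Thus matrix units become the characteristic functions of their graphs, $d \in \mathcal{D}$ is supported on $\{(x,x)\}$ with $d(x,x) = d(x)$, and multiplication is $f \cdot g(x,y) = \sum_u f(x,u)g(u,y)$, with $u$ ranging over the equivalence class of $x$. For a $\mathcal{D}$-bimodule $\mathcal{C} \subseteq \mathcal{B}$, $\operatorname{spec}(\mathcal{C}) = \{(x,y) \in G \mid f(x,y) \neq 0 \text{ for some } f \in \mathcal{C}\}$. In particular $\operatorname{spec}(\mathcal{D}) = \{(x,x) \mid x \in X\}$. *)

theory Defs
  imports "HOL-Analysis.Analysis"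
begin

text \<open>
  Unital complex C*-algebras. The underlying real Banach algebra is that of the library; the class
  adds complex scalars extending the real ones, and the involution.
\<close>

class cstar_algebra = real_normed_algebra_1 + banach +
  fixes scaleC :: "complex \<Rightarrow> 'a \<Rightarrow> 'a"  (infixr \<open>*\<^sub>C\<close> 75)
    and star :: "'a \<Rightarrow> 'a"
  assumes scaleC_add_right: "c *\<^sub>C (x + y) = c *\<^sub>C x + c *\<^sub>C y"
    and scaleC_add_left: "(c + d) *\<^sub>C x = c *\<^sub>C x + d *\<^sub>C x"
    and scaleC_scaleC: "c *\<^sub>C d *\<^sub>C x = (c * d) *\<^sub>C x"
    and scaleC_of_real: "complex_of_real r *\<^sub>C x = r *\<^sub>R x"
    and scaleC_mult_left: "(c *\<^sub>C x) * y = c *\<^sub>C (x * y)"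
    and scaleC_mult_right: "x * (c *\<^sub>C y) = c *\<^sub>C (x * y)"
    and norm_scaleC: "norm (c *\<^sub>C x) = cmod c * norm x"
    and star_star: "star (star x) = x"
    and star_add: "star (x + y) = star x + star y"
    and star_scaleC: "star (c *\<^sub>C x) = cnj c *\<^sub>C star x"
    and star_mult: "star (x * y) = star y * star x"
    and cstar_identity: "norm (star x * x) = (norm x)\<^sup>2"

global_interpretation complex_vs: vector_space "scaleC :: complex \<Rightarrow> 'a \<Rightarrow> 'a::cstar_algebra"
  defines csubspace = complex_vs.subspace
    and cspan = complex_vs.span
proof
  fix c d :: complex and x y :: 'a
  show "c *\<^sub>C (x + y) = c *\<^sub>C x + c *\<^sub>C y" by (rule scaleC_add_right)
  show "(c + d) *\<^sub>C x = c *\<^sub>C x + d *\<^sub>C x" by (rule scaleC_add_left)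
  show "c *\<^sub>C d *\<^sub>C x = (c * d) *\<^sub>C x" by (rule scaleC_scaleC)
  show "1 *\<^sub>C x = x" using scaleC_of_real[of 1 x] by simp
qed

definition csubalgebra :: "'a::cstar_algebra set \<Rightarrow> bool" where
  "csubalgebra A \<longleftrightarrow> csubspace A \<and> (\<forall>x\<in>A. \<forall>y\<in>A. x * y \<in> A)"

definition cstar_subalgebra :: "'a::cstar_algebra set \<Rightarrow> bool" where
  "cstar_subalgebra A \<longleftrightarrow> csubalgebra A \<and> star ` A \<subseteq> A \<and> closed A"

definition lie_ideal :: "'a::cstar_algebra set \<Rightarrow> 'a set \<Rightarrow> bool" where
  "lie_ideal A L \<longleftrightarrow> csubspace L \<and> L \<subseteq> A \<and> (\<forall>x\<in>L. \<forall>a\<in>A. x * a - a * x \<in> L)"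

definition assoc_ideal :: "'a::cstar_algebra set \<Rightarrow> 'a set \<Rightarrow> bool" where
  "assoc_ideal A K \<longleftrightarrow>
    csubspace K \<and> K \<subseteq> A \<and> (\<forall>x\<in>K. \<forall>a\<in>A. x * a \<in> K \<and> a * x \<in> K)"

text \<open>
  A system of matrix units for a finite-dimensional algebra, that is, for a direct sum of full
  matrix algebras: \<open>r\<close> is an equivalence relation on the finite index set \<open>Field r\<close> whose classes
  are the blocks, and \<open>e i j\<close> is meaningful only for \<open>(i, j) \<in> r\<close>. Linear independence of the
  matrix units follows from the relations, and if \<open>C\<close> contains the unit, then \<open>e i i\<close> sum to it.
\<close>

definition matrix_units ::
    "'a::cstar_algebra set \<Rightarrow> (nat \<times> nat) set \<Rightarrow> (nat \<Rightarrow> nat \<Rightarrow> 'a) \<Rightarrow> bool" where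
  "matrix_units C r e \<longleftrightarrow>
    finite r \<and> equiv (Field r) r \<and>
    (\<forall>(i, j)\<in>r. e i j \<noteq> 0 \<and> star (e i j) = e j i) \<and>
    (\<forall>(i, j)\<in>r. \<forall>(k, l)\<in>r. e i j * e k l = (if j = k then e i l else 0)) \<and>
    C = cspan {e i j | i j. (i, j) \<in> r}"

text \<open>
  The whole type is the AF algebra \<open>\<B>\<close>; the locale holds the data defining a canonical diagonal.
\<close>

locale canonical_diagonal =
  fixes B :: "nat \<Rightarrow> 'a::cstar_algebra set"
    and R :: "nat \<Rightarrow> (nat \<times> nat) set"
    and e :: "nat \<Rightarrow> nat \<Rightarrow> nat \<Rightarrow> 'a"
  assumes cstar_subalgebra: "cstar_subalgebra (B n)"
    and finite_dim: "\<exists>T. finite T \<and> B n = cspan T"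
    and unit_mem: "1 \<in> B n"
    and increasing: "B n \<subseteq> B (Suc n)"
    and dense_union: "closure (\<Union>n. B n) = UNIV"
    and matrix_units: "matrix_units (B n) (R n) (e n)"
    and sum_of_units: "(i, j) \<in> R n \<Longrightarrow>
      \<exists>T \<subseteq> R (Suc n). e n i j = (\<Sum>(k, l)\<in>T. e (Suc n) k l)"

definition diag_masa ::
    "(nat \<Rightarrow> (nat \<times> nat) set) \<Rightarrow> (nat \<Rightarrow> nat \<Rightarrow> nat \<Rightarrow> 'a::cstar_algebra) \<Rightarrow> nat \<Rightarrow> 'a set" where
  "diag_masa R e n = cspan {e n i i | i. i \<in> Field (R n)}"

definition diagonal ::
    "(nat \<Rightarrow> (nat \<times> nat) set) \<Rightarrow> (nat \<Rightarrow> nat \<Rightarrow> nat \<Rightarrow> 'a::cstar_algebra) \<Rightarrow> 'a set" where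
  "diagonal R e = closure (\<Union>n. diag_masa R e n)"

definition all_units ::
    "(nat \<Rightarrow> (nat \<times> nat) set) \<Rightarrow> (nat \<Rightarrow> nat \<Rightarrow> nat \<Rightarrow> 'a::cstar_algebra) \<Rightarrow> 'a set" where
  "all_units R e = {e n i j | n i j. (i, j) \<in> R n}"

text \<open>
  Points of the spectrum are characters. They are functionals on \<open>D\<close> only, hence extensional on
  \<open>D\<close>, so that distinct points differ on \<open>D\<close>. The Gelfand transform of \<open>d\<close> at \<open>x\<close> is \<open>x d\<close>.
\<close>

definition gelfand_spectrum :: "'a::cstar_algebra set \<Rightarrow> ('a \<Rightarrow> complex) set" where
  "gelfand_spectrum D = {x \<in> extensional D.
    (\<exists>d\<in>D. x d \<noteq> 0) \<and>
    (\<forall>d\<in>D. \<forall>d'\<in>D. x (d + d') = x d + x d' \<and> x (d * d') = x d * x d') \<and>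
    (\<forall>c. \<forall>d\<in>D. x (c *\<^sub>C d) = c * x d)}"

definition unit_homeo ::
    "'a::cstar_algebra set \<Rightarrow> 'a \<Rightarrow> ('a \<Rightarrow> complex) \<Rightarrow> 'a \<Rightarrow> complex" where
  "unit_homeo D u y = (\<lambda>d\<in>D. y (star u * d * u))"

definition unit_graph ::
    "'a::cstar_algebra set \<Rightarrow> 'a \<Rightarrow> (('a \<Rightarrow> complex) \<times> ('a \<Rightarrow> complex)) set" where
  "unit_graph D u = {(unit_homeo D u y, y) | y. y \<in> gelfand_spectrum D \<and> y (star u * u) = 1}"

definition groupoid ::
    "(nat \<Rightarrow> (nat \<times> nat) set) \<Rightarrow> (nat \<Rightarrow> nat \<Rightarrow> nat \<Rightarrow> 'a::cstar_algebra) \<Rightarrow>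
     (('a \<Rightarrow> complex) \<times> ('a \<Rightarrow> complex)) set" where
  "groupoid R e = (\<Union>u\<in>all_units R e. unit_graph (diagonal R e) u)"

definition cond_exp ::
    "(nat \<Rightarrow> (nat \<times> nat) set) \<Rightarrow> (nat \<Rightarrow> nat \<Rightarrow> nat \<Rightarrow> 'a::cstar_algebra) \<Rightarrow> 'a \<Rightarrow> 'a" where
  "cond_exp R e f = lim (\<lambda>n. \<Sum>i\<in>Field (R n). e n i i * f * e n i i)"

text \<open>
  The value \<open>f(x,y)\<close> for \<open>(x, y)\<close> in the groupoid; it does not depend on the matrix unit chosen.
\<close>

definition coord ::
    "(nat \<Rightarrow> (nat \<times> nat) set) \<Rightarrow> (nat \<Rightarrow> nat \<Rightarrow> nat \<Rightarrow> 'a::cstar_algebra) \<Rightarrow> 'a \<Rightarrow>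
     ('a \<Rightarrow> complex) \<Rightarrow> ('a \<Rightarrow> complex) \<Rightarrow> complex" where
  "coord R e f x y =
    (let u = SOME u. u \<in> all_units R e \<and> (x, y) \<in> unit_graph (diagonal R e) u
     in x (cond_exp R e (f * star u)))"

definition spec ::
    "(nat \<Rightarrow> (nat \<times> nat) set) \<Rightarrow> (nat \<Rightarrow> nat \<Rightarrow> nat \<Rightarrow> 'a::cstar_algebra) \<Rightarrow> 'a set \<Rightarrow>
     (('a \<Rightarrow> complex) \<times> ('a \<Rightarrow> complex)) set" where
  "spec R e C = {(x, y) \<in> groupoid R e. \<exists>f\<in>C. coord R e f x y \<noteq> 0}"

text \<open>
  Norm-closedness of \<open>A\<close> is not part of this notion.
\<close>

definition triangular :: "'a::cstar_algebra set \<Rightarrow> 'a set \<Rightarrow> bool" where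
  "triangular D A \<longleftrightarrow> csubalgebra A \<and> D \<subseteq> A \<and> A \<inter> star ` A = D"

definition const_on_rel ::
    "(nat \<Rightarrow> (nat \<times> nat) set) \<Rightarrow> (nat \<Rightarrow> nat \<Rightarrow> nat \<Rightarrow> 'a::cstar_algebra) \<Rightarrow>
     (('a \<Rightarrow> complex) \<times> ('a \<Rightarrow> complex)) set \<Rightarrow> 'a set" where
  "const_on_rel R e Q = {f \<in> diagonal R e. \<forall>(x, y)\<in>Q. coord R e f x x = coord R e f y y}"

end

theory Submission
  imports Defs
begin

text \<open>
  Let \<open>\<pi>\<close> be the conditional expectation of \<open>\<B>\<close> onto \<open>\<D>\<close>. Commutators with orthogonal projections
  \<open>p\<close>, \<open>q\<close> of \<open>\<D>\<close> cut the corner \<open>p f q\<close> out of an element \<open>f\<close> of \<open>\<L>\<close> (\<open>corner_in_L\<close>). The element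
  \<open>f - \<pi> f\<close> is a limit of sums of such corners, so it lies in \<open>\<L>\<close>, and \<open>\<L>\<close> is the sum of \<open>\<F> = \<L> \<inter> \<D>\<close> and
  \<open>\<K> = \<L> \<inter> ker \<pi>\<close>.

  The main point is that \<open>\<K>\<close> is an associative ideal. It suffices to multiply a corner \<open>g = p f q\<close> by
  an element \<open>a\<close> of \<open>\<A>\<close>. The part of \<open>g a\<close> outside the corner of \<open>p\<close> is itself a commutator of \<open>g\<close> with
  an element of \<open>\<A>\<close>. The part \<open>g a p\<close> is one term of the commutator \<open>h = g a p - q a g\<close>; it is
  recovered as \<open>p h\<close>, which belongs to \<open>\<L>\<close> provided that \<open>\<pi> h = 0\<close> (\<open>corner_mult_in_L\<close>).

  This last equation holds because \<open>\<pi>\<close> is multiplicative on \<open>\<A>\<close> (\<open>\<pi>_mult\<close>). In coordinates,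
  \<open>(f b)(x,x)\<close> is the sum of \<open>f(x,u) b(u,x)\<close> over \<open>u\<close>, and triangularity makes the spectrum of \<open>\<A>\<close>
  antisymmetric, so that only \<open>u = x\<close> contributes. The proof replaces points by matrix units: for a
  unit \<open>u\<close> off the diagonal, the functions \<open>\<pi> (f u\<^sup>*)\<close> and \<open>\<pi> (u b)\<close> have product zero
  (\<open>offdiagonal_coefficients_disjoint\<close>), and \<open>\<pi> (f b)\<close> is approximated by the sums of these products
  over the units of a level with an error governed by the distance from \<open>f\<close> to that level
  (\<open>norm_\<pi>_mult_diff_le\<close>).

  Finally, let \<open>d\<close> be in \<open>\<F>\<close> and \<open>f\<close> in \<open>\<A>\<close>. The commutator \<open>d f - f d\<close> is in \<open>\<K>\<close>, and its coordinate at
  \<open>(x,y)\<close> is \<open>(d(x) - d(y)) f(x,y)\<close> (\<open>coord_commutator\<close>). If \<open>f(x,y)\<close> is nonzero and \<open>(x,y)\<close> is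
  outside the spectrum of \<open>\<K>\<close>, this forces \<open>d(x) = d(y)\<close>.
\<close>

section \<open>C*-algebra preliminaries\<close>

lemma csubspace_scaleR: "csubspace V \<Longrightarrow> x \<in> V \<Longrightarrow> r *\<^sub>R x \<in> V"
  by (metis complex_vs.subspace_scale scaleC_of_real)

lemma star_scaleR: "star (r *\<^sub>R x) = r *\<^sub>R star (x::'a::cstar_algebra)"
  by (metis complex_cnj_complex_of_real scaleC_of_real star_scaleC)

lemma norm_star [simp]: "norm (star x) = norm (x::'a::cstar_algebra)"
proof -
  have le: "norm y \<le> norm (star y)" for y :: 'a
  proof (cases "norm y = 0")
    case False
    have "norm y * norm y \<le> norm (star y) * norm y"
      using norm_mult_ineq[of "star y" y] by (simp add: cstar_identity power2_eq_square)
    then show ?thesis using False by simp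
  qed simp
  show ?thesis using le[of x] le[of "star x"] by (simp add: star_star)
qed

lemma bounded_linear_star: "bounded_linear (star :: 'a::cstar_algebra \<Rightarrow> 'a)"
  by (rule bounded_linear_intro[of _ 1]) (simp_all add: star_add star_scaleR)

lemmas star_sum = linear_sum[OF bounded_linear.linear[OF bounded_linear_star]]
lemmas star_zero [simp] = linear_0[OF bounded_linear.linear[OF bounded_linear_star]]

lemma star_one [simp]: "star (1::'a::cstar_algebra) = 1"
  by (metis mult_1 mult_1_right star_mult star_star)

lemma bounded_linear_scaleC: "bounded_linear (scaleC c :: 'a::cstar_algebra \<Rightarrow> 'a)"
proof (rule bounded_linear_intro[of _ "cmod c"])
  fix r and x :: 'a
  show "c *\<^sub>C r *\<^sub>R x = r *\<^sub>R c *\<^sub>C x"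
    by (metis mult.commute scaleC_of_real scaleC_scaleC)
qed (simp_all add: scaleC_add_right norm_scaleC mult.commute)

lemmas scaleC_sum = linear_sum[OF bounded_linear.linear[OF bounded_linear_scaleC]]

lemma star_mult_self_eq_0: "star x * x = 0 \<Longrightarrow> x = (0::'a::cstar_algebra)"
  by (metis cstar_identity norm_eq_zero zero_eq_power2)

lemma norm_projection_le:
  fixes p :: "'a::cstar_algebra"
  assumes "star p = p" "p * p = p"
  shows "norm p \<le> 1"
proof -
  have "norm p * norm p = norm p"
    using cstar_identity[of p] assms by (simp add: power2_eq_square)
  then show ?thesis by auto
qed

text \<open>
  Elements with pairwise orthogonal initial and final spaces should add up to an element whose norm
  is the maximum of their norms. The C*-identity turns the sum into
  \<open>\<Sum>i\<in>I. star (y i) * y i\<close>, a sum of the same kind, at the price of squaring the norms, while the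
  factor \<open>card I\<close> lost in the triangle inequality stays the same. Letting \<open>k\<close> grow makes
  that factor negligible after a root of order \<open>2 ^ k\<close> is taken.
\<close>

lemma norm_orthogonal_sum_power:
  fixes y :: "'i \<Rightarrow> 'a::cstar_algebra"
  assumes "\<And>i. i \<in> I \<Longrightarrow> norm (y i) \<le> c" "finite I"
    and "\<And>i j. \<lbrakk>i \<in> I; j \<in> I; i \<noteq> j\<rbrakk> \<Longrightarrow> star (y i) * y j = 0"
    and "\<And>i j. \<lbrakk>i \<in> I; j \<in> I; i \<noteq> j\<rbrakk> \<Longrightarrow> y i * star (y j) = 0"
  shows "norm (sum y I) ^ 2 ^ k \<le> real (card I) * c ^ 2 ^ k"
  using assms
proof (induction k arbitrary: y c)
  case 0
  then show ?case using sum_norm_bound[of I y c] by simp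
next
  case (Suc k)
  let ?z = "\<lambda>i. star (y i) * y i"
  have "star (sum y I) * sum y I = (\<Sum>i\<in>I. \<Sum>j\<in>I. star (y i) * y j)"
    by (simp add: star_sum sum_product)
  also have "\<dots> = (\<Sum>i\<in>I. \<Sum>j\<in>I. if i = j then ?z i else 0)"
    using Suc.prems by (intro sum.cong) auto
  also have "\<dots> = sum ?z I"
    using Suc.prems(2) by simp
  finally have sq: "norm (sum y I) ^ 2 = norm (sum ?z I)"
    by (metis cstar_identity)
  have "norm (sum ?z I) ^ 2 ^ k \<le> real (card I) * (c\<^sup>2) ^ 2 ^ k"
  proof (rule Suc.IH)
    fix i assume "i \<in> I"
    then show "norm (?z i) \<le> c\<^sup>2"
      using Suc.prems(1) by (simp add: cstar_identity power_mono)
  next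
    fix i j assume ij: "i \<in> I" "j \<in> I" "i \<noteq> j"
    have "star (y i) * (y i * star (y j)) * y j = 0"
      using Suc.prems(4)[OF ij] by simp
    then show "star (?z i) * ?z j = 0" "?z i * star (?z j) = 0"
      by (simp_all add: star_mult star_star mult.assoc)
  qed (fact Suc.prems)
  moreover have "norm (sum ?z I) ^ 2 ^ k = norm (sum y I) ^ 2 ^ Suc k"
    unfolding sq[symmetric] by (simp only: power_mult[symmetric] power_Suc)
  moreover have "(c\<^sup>2) ^ 2 ^ k = c ^ 2 ^ Suc k"
    by (simp only: power_mult[symmetric] power_Suc)
  ultimately show ?case by simp
qed

lemma norm_orthogonal_sum_le:
  fixes y :: "'i \<Rightarrow> 'a::cstar_algebra"
  assumes bound: "\<And>i. i \<in> I \<Longrightarrow> norm (y i) \<le> c" and "finite I" "0 \<le> c"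
    and "\<And>i j. \<lbrakk>i \<in> I; j \<in> I; i \<noteq> j\<rbrakk> \<Longrightarrow> star (y i) * y j = 0"
    and "\<And>i j. \<lbrakk>i \<in> I; j \<in> I; i \<noteq> j\<rbrakk> \<Longrightarrow> y i * star (y j) = 0"
  shows "norm (sum y I) \<le> c"
proof (rule ccontr)
  let ?s = "norm (sum y I)"
  assume "\<not> ?s \<le> c"
  then have gt: "c < ?s" by simp
  have pow: "?s ^ 2 ^ k \<le> real (card I) * c ^ 2 ^ k" for k
    by (rule norm_orthogonal_sum_power[OF bound \<open>finite I\<close>]) (simp_all add: assms)
  have "c \<noteq> 0" using pow[of 0] gt by auto
  then have c: "0 < c" using \<open>0 \<le> c\<close> by simp
  then have gt1: "1 < ?s / c" using gt by simp
  then obtain k where k: "real (card I) < (?s / c) ^ k"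
    using real_arch_pow by blast
  have "k \<le> 2 ^ k" using less_exp[of k] by simp
  then have "(?s / c) ^ k \<le> (?s / c) ^ 2 ^ k"
    using gt1 by (intro power_increasing) auto
  also have "\<dots> \<le> card I"
    using pow[of k] c by (simp add: power_divide divide_le_eq)
  finally show False using k by simp
qed

lemma csubspace_closure:
  assumes V: "csubspace (V::'a::cstar_algebra set)"
  shows "csubspace (closure V)"
  unfolding complex_vs.subspace_def
proof (intro conjI allI ballI)
  show "0 \<in> closure V"
    using complex_vs.subspace_0[OF V] closure_subset by blast
next
  fix x y assume "x \<in> closure V" "y \<in> closure V"
  then obtain f g where "\<And>n. f n \<in> V" "f \<longlonglongrightarrow> x" "\<And>n. g n \<in> V" "g \<longlonglongrightarrow> y"
    unfolding closure_sequential by blast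
  then show "x + y \<in> closure V"
    unfolding closure_sequential
    by (intro exI[of _ "\<lambda>n. f n + g n"]) (simp add: complex_vs.subspace_add[OF V] tendsto_add)
next
  fix c x assume "x \<in> closure V"
  then obtain f where "\<And>n. f n \<in> V" "f \<longlonglongrightarrow> x"
    unfolding closure_sequential by blast
  then show "c *\<^sub>C x \<in> closure V"
    unfolding closure_sequential
    by (intro exI[of _ "\<lambda>n. c *\<^sub>C f n"])
      (simp add: complex_vs.subspace_scale[OF V] bounded_linear.tendsto[OF bounded_linear_scaleC])
qed

section \<open>Matrix units at successive levels\<close>

context canonical_diagonal
begin

abbreviation D :: "'a set" where "D \<equiv> diagonal R e"
abbreviation I :: "nat \<Rightarrow> nat set" where "I n \<equiv> Field (R n)"

lemma finite_R: "finite (R n)" and equiv_R: "equiv (I n) (R n)"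
  and B_eq: "B n = cspan {e n i j | i j. (i, j) \<in> R n}"
  using matrix_units[of n] by (simp_all add: matrix_units_def)

lemma finite_I [simp]: "finite (I n)"
  using finite_R by (simp add: finite_Field)

lemma unit_nonzero: "(i, j) \<in> R n \<Longrightarrow> e n i j \<noteq> 0"
  and star_unit: "(i, j) \<in> R n \<Longrightarrow> star (e n i j) = e n j i"
  using matrix_units[of n] by (auto simp: matrix_units_def)

lemma unit_mult:
  assumes "(i, j) \<in> R n" "(k, l) \<in> R n"
  shows "e n i j * e n k l = (if j = k then e n i l else 0)"
proof -
  have "\<forall>(i, j)\<in>R n. \<forall>(k, l)\<in>R n. e n i j * e n k l = (if j = k then e n i l else 0)"
    using matrix_units[of n] unfolding matrix_units_def by (elim conjE)
  from bspec[OF this assms(1)] show ?thesis by (auto dest: bspec[OF _ assms(2)])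
qed

lemma R_refl: "i \<in> I n \<Longrightarrow> (i, i) \<in> R n"
  and R_sym: "(i, j) \<in> R n \<Longrightarrow> (j, i) \<in> R n"
  and R_trans: "(i, j) \<in> R n \<Longrightarrow> (j, k) \<in> R n \<Longrightarrow> (i, k) \<in> R n"
  using equiv_R[of n] by (meson equivE refl_onD symD transD)+

lemma R_Field: "(i, j) \<in> R n \<Longrightarrow> i \<in> I n" "(i, j) \<in> R n \<Longrightarrow> j \<in> I n"
  by (auto simp: Field_def)

lemma star_diag: "i \<in> I n \<Longrightarrow> star (e n i i) = e n i i"
  and diag_mult: "i \<in> I n \<Longrightarrow> j \<in> I n \<Longrightarrow> e n i i * e n j j = (if i = j then e n i i else 0)"
  by (simp_all add: star_unit unit_mult R_refl)

lemma sum_diag: "(\<Sum>i\<in>I n. e n i i) = 1"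
proof -
  let ?s = "\<Sum>i\<in>I n. e n i i"
  have "1 \<in> cspan {e n i j | i j. (i, j) \<in> R n}"
    using unit_mem[of n] unfolding B_eq .
  then have "?s * 1 = 1"
  proof (induction rule: complex_vs.span_induct_alt)
    case (step c x y)
    from step(1) obtain i j where ij: "x = e n i j" "(i, j) \<in> R n" by blast
    have "?s * x = (\<Sum>k\<in>I n. if k = i then e n i j else 0)"
      unfolding sum_distrib_right ij
      using ij(2) by (intro sum.cong) (auto simp: unit_mult R_refl)
    then have "?s * x = x" using ij R_Field by simp
    then show ?case using step(2) by (simp add: distrib_left scaleC_mult_right)
  qed simp
  then show ?thesis by simp
qed

context
  fixes n and T and u :: 'a
  assumes T: "T \<subseteq> R n" and u: "u = (\<Sum>(k, l)\<in>T. e n k l)"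
begin

lemma unit_sum_row: "k \<in> I n \<Longrightarrow> e n k k * u = (\<Sum>l\<in>T `` {k}. e n k l)"
proof -
  assume k: "k \<in> I n"
  have fin: "finite T" using T by (rule finite_subset) (rule finite_R)
  have "e n k k * u = (\<Sum>t\<in>T. if fst t = k then e n k (snd t) else 0)"
    unfolding u sum_distrib_left using T k
    by (intro sum.cong) (auto simp: unit_mult R_refl)
  also have "\<dots> = (\<Sum>t\<in>{t \<in> T. fst t = k}. e n k (snd t))"
    using fin by (simp add: sum.inter_filter)
  also have "\<dots> = (\<Sum>l\<in>T `` {k}. e n k l)"
    by (rule sum.reindex_bij_witness[where i = "\<lambda>l. (k, l)" and j = snd]) auto
  finally show ?thesis .
qed

lemma unit_sum_compress:
  assumes k: "k \<in> I n"
  shows "e n k k * u * e n k k = (if (k, k) \<in> T then e n k k else 0)"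
proof -
  have fin: "finite (T `` {k})" by (rule finite_Image[OF finite_subset[OF T finite_R]])
  have "e n k k * u * e n k k = (\<Sum>l\<in>T `` {k}. if l = k then e n k k else 0)"
    unfolding unit_sum_row[OF k] sum_distrib_right using T k
    by (intro sum.cong) (auto simp: unit_mult R_refl)
  then show ?thesis using fin by simp
qed

text \<open>
  The diagonal entry of \<open>u * star u\<close> counts the units of the \<open>k\<close>-th row that occur in \<open>u\<close>. When
  \<open>u\<close> is a matrix unit of the previous level, \<open>u * star u\<close> is again a sum of units, whose diagonal
  entries are 0 or 1 by \<open>unit_sum_compress\<close>; so at most one unit per row can occur. This is how the
  shape of the embeddings between levels is read off.
\<close>

lemma unit_sum_gram:
  assumes k: "k \<in> I n"
  shows "e n k k * (u * star u) * e n k k = real (card (T `` {k})) *\<^sub>R e n k k"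
proof -
  have fin: "finite (T `` {k})" by (rule finite_Image[OF finite_subset[OF T finite_R]])
  have "e n k k * (u * star u) * e n k k = (e n k k * u) * star (e n k k * u)"
    using k by (simp add: star_mult star_diag mult.assoc)
  also have "\<dots> = (\<Sum>l\<in>T `` {k}. \<Sum>l'\<in>T `` {k}. e n k l * star (e n k l'))"
    unfolding unit_sum_row[OF k] by (simp add: star_sum sum_product)
  also have "\<dots> = (\<Sum>l\<in>T `` {k}. \<Sum>l'\<in>T `` {k}. if l = l' then e n k k else 0)"
    using T by (intro sum.cong refl) (auto simp: star_unit unit_mult R_sym subset_iff)
  also have "\<dots> = real (card (T `` {k})) *\<^sub>R e n k k"
    using fin by (simp add: scaleR_conv_of_real sum_constant)
  finally show ?thesis .
qed

end

lemma diag_eq_sum_diag_Suc: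
  assumes i: "i \<in> I n"
  shows "\<exists>T\<subseteq>I (Suc n). e n i i = (\<Sum>k\<in>T. e (Suc n) k k)"
proof -
  from sum_of_units[OF R_refl[OF i]] obtain T
    where T: "T \<subseteq> R (Suc n)" and eq: "e n i i = (\<Sum>(k, l)\<in>T. e (Suc n) k l)" by blast
  have diag: "k = l" if kl: "(k, l) \<in> T" for k l
  proof -
    from kl T have k: "k \<in> I (Suc n)" using R_Field by blast
    have fin: "finite (T `` {k})" by (rule finite_Image[OF finite_subset[OF T finite_R]])
    then have card: "card (T `` {k}) \<noteq> 0" using kl by auto
    have "e n i i * star (e n i i) = e n i i" using i by (simp add: star_diag diag_mult)
    then have "real (card (T `` {k})) *\<^sub>R e (Suc n) k k = (if (k, k) \<in> T then e (Suc n) k k else 0)"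
      using unit_sum_gram[OF T eq k] unit_sum_compress[OF T eq k] by simp
    then have "(k, k) \<in> T" "card (T `` {k}) = 1"
      using card unit_nonzero[OF R_refl[OF k]]
        scaleR_cancel_right[of "real (card (T `` {k}))" "e (Suc n) k k" 1]
      by (auto split: if_splits)
    then have "k \<in> T `` {k}" "l \<in> T `` {k}" using kl by auto
    moreover obtain x where "T `` {k} = {x}"
      using card_1_singletonE[OF \<open>card (T `` {k}) = 1\<close>] .
    ultimately show ?thesis by (simp only: singleton_iff)
  qed
  have "(\<Sum>(k, l)\<in>T. e (Suc n) k l) = (\<Sum>k\<in>Domain T. e (Suc n) k k)"
    using diag by (intro sum.reindex_bij_witness[where i = "\<lambda>k. (k, k)" and j = fst]) (auto, metis)
  moreover have "Domain T \<subseteq> I (Suc n)" using T by (auto simp: Field_def)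
  ultimately show ?thesis using eq by auto
qed

text \<open>
  An earlier diagonal unit is a sum of orthogonal diagonal units of the next level, and at most one
  of them can dominate a given minimal projection. All computations between levels rest on this
  dichotomy.
\<close>

lemma diag_le_or_orthogonal:
  assumes "n \<le> m" "i \<in> I n" "k \<in> I m"
  shows "e n i i * e m k k = e m k k \<or> e n i i * e m k k = 0"
  using assms
proof (induction n arbitrary: i rule: inc_induct)
  case base
  then show ?case by (auto simp: diag_mult)
next
  case (step n)
  from diag_eq_sum_diag_Suc[OF step.prems(1)] obtain T
    where T: "T \<subseteq> I (Suc n)" and eq: "e n i i = (\<Sum>l\<in>T. e (Suc n) l l)" by blast
  have fin: "finite T" using T by (rule finite_subset) (rule finite_I)
  show ?case
  proof (cases "\<exists>l\<in>T. e (Suc n) l l * e m k k = e m k k")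
    case True
    then obtain l where l: "l \<in> T" "e (Suc n) l l * e m k k = e m k k" by blast
    have "e n i i * e m k k = e n i i * (e (Suc n) l l * e m k k)" by (simp add: l)
    also have "\<dots> = (\<Sum>l'\<in>T. if l' = l then e (Suc n) l l else 0) * e m k k"
      unfolding eq mult.assoc[symmetric] sum_distrib_right using T l(1)
      by (intro arg_cong2[where f = "(*)"] sum.cong) (auto simp: diag_mult subset_iff sum_distrib_right intro!: sum.cong)
    finally show ?thesis using fin l by simp
  next
    case False
    then have "e n i i * e m k k = 0"
      unfolding eq sum_distrib_right using step T by (intro sum.neutral) blast
    then show ?thesis by simp
  qed
qed

lemma diag_absorbs:
  assumes "n \<le> m" "i \<in> I n" "k \<in> I m"
  shows "e n i i * e m k k = e m k k \<and> e m k k * e n i i = e m k k \<or>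
         e n i i * e m k k = 0 \<and> e m k k * e n i i = 0"
proof -
  have "e m k k * e n i i = star (e n i i * e m k k)"
    using assms by (simp add: star_mult star_diag)
  then show ?thesis
    using diag_le_or_orthogonal[OF assms] assms by (auto simp: star_diag)
qed

section \<open>The canonical diagonal\<close>

lemma diag_in_masa: "i \<in> I n \<Longrightarrow> e n i i \<in> diag_masa R e n"
  unfolding diag_masa_def by (rule complex_vs.span_base) blast

lemma csubspace_masa: "csubspace (diag_masa R e n)"
  unfolding diag_masa_def by (rule complex_vs.subspace_span)

lemma masa_mono: "n \<le> m \<Longrightarrow> diag_masa R e n \<subseteq> diag_masa R e m"
proof (rule lift_Suc_mono_le)
  fix n
  have "e n i i \<in> diag_masa R e (Suc n)" if "i \<in> I n" for i
  proof -
    from diag_eq_sum_diag_Suc[OF that] obtain T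
      where "T \<subseteq> I (Suc n)" "e n i i = (\<Sum>k\<in>T. e (Suc n) k k)" by blast
    then show ?thesis
      by (auto intro!: complex_vs.subspace_sum[OF csubspace_masa] diag_in_masa)
  qed
  then show "diag_masa R e n \<subseteq> diag_masa R e (Suc n)"
    unfolding diag_masa_def[of R e n]
    by (intro complex_vs.span_minimal csubspace_masa) auto
qed

lemma diag_in_D: "i \<in> I n \<Longrightarrow> e n i i \<in> D"
  unfolding diagonal_def by (rule subsetD[OF closure_subset]) (auto intro: diag_in_masa)

lemma closed_D: "closed D"
  by (simp add: diagonal_def)

lemma csubspace_D: "csubspace D"
proof -
  have "csubspace (\<Union>n. diag_masa R e n)"
    unfolding complex_vs.subspace_def
  proof (intro conjI allI ballI)
    show "0 \<in> (\<Union>n. diag_masa R e n)"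
      using complex_vs.subspace_0[OF csubspace_masa] by blast
  next
    fix x y assume "x \<in> (\<Union>n. diag_masa R e n)" "y \<in> (\<Union>n. diag_masa R e n)"
    then obtain n m where "x \<in> diag_masa R e n" "y \<in> diag_masa R e m" by blast
    then have "x \<in> diag_masa R e (max n m)" "y \<in> diag_masa R e (max n m)"
      using masa_mono[of n "max n m"] masa_mono[of m "max n m"] by auto
    then show "x + y \<in> (\<Union>n. diag_masa R e n)"
      using complex_vs.subspace_add[OF csubspace_masa] by blast
  next
    fix c x assume "x \<in> (\<Union>n. diag_masa R e n)"
    then show "c *\<^sub>C x \<in> (\<Union>n. diag_masa R e n)"
      using complex_vs.subspace_scale[OF csubspace_masa] by blast
  qed
  then show ?thesis unfolding diagonal_def by (rule csubspace_closure)
qed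

text \<open>
  The induction principle for \<open>\<D>\<close>: a closed linear condition need only be checked on diagonal
  matrix units, and only on those of late levels, because the masas increase.
\<close>

lemma diagonal_subset:
  assumes V: "csubspace V" "closed V" and gen: "\<And>m i. n \<le> m \<Longrightarrow> i \<in> I m \<Longrightarrow> e m i i \<in> V"
  shows "D \<subseteq> V"
  unfolding diagonal_def
proof (rule closure_minimal[OF _ V(2)], rule UN_least)
  fix m
  have "diag_masa R e m \<subseteq> diag_masa R e (max n m)" by (rule masa_mono) simp
  also have "\<dots> \<subseteq> V"
    unfolding diag_masa_def using gen[of "max n m"]
    by (intro complex_vs.span_minimal V(1)) auto
  finally show "diag_masa R e m \<subseteq> V" .
qed

lemma algebra_subset:
  assumes V: "csubspace V" "closed V" and gen: "\<And>m i j. (i, j) \<in> R m \<Longrightarrow> e m i j \<in> V"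
  shows "x \<in> V"
proof -
  have "B m \<subseteq> V" for m
    unfolding B_eq using gen by (intro complex_vs.span_minimal V(1)) auto
  then have "closure (\<Union>m. B m) \<subseteq> V"
    by (intro closure_minimal V(2)) blast
  then show ?thesis unfolding dense_union by blast
qed

lemma D_commute:
  assumes "c \<in> D" "d \<in> D"
  shows "c * d = d * c"
proof -
  have sub: "csubspace {x. x * y = y * x}" for y :: 'a
    by (auto simp: complex_vs.subspace_def distrib_left distrib_right scaleC_mult_left scaleC_mult_right)
  have cl: "closed {x. x * y = y * x}" for y :: 'a
    by (intro closed_Collect_eq continuous_intros)
  have gen: "e m i i * e k j j = e k j j * e m i i" if "i \<in> I m" "j \<in> I k" for m i k j
    using diag_absorbs[of m k i j] diag_absorbs[of k m j i] that by (cases "m \<le> k") auto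
  have 1: "D \<subseteq> {x. x * e k j j = e k j j * x}" if "j \<in> I k" for k j
    using gen that by (intro diagonal_subset sub cl) auto
  have "e k j j * c = c * e k j j" if "j \<in> I k" for k j
    using 1[OF that] assms(1) by auto
  then have "D \<subseteq> {x. x * c = c * x}"
    by (intro diagonal_subset sub cl) auto
  then show ?thesis using assms(2) by auto
qed

lemma D_one: "1 \<in> D"
  unfolding sum_diag[of 0, symmetric]
  by (intro complex_vs.subspace_sum[OF csubspace_D] diag_in_D)

lemma D_mult:
  assumes "c \<in> D" "d \<in> D"
  shows "c * d \<in> D"
proof -
  have gen: "e m i i * e k j j \<in> D" if "i \<in> I m" "j \<in> I k" for m i k j
    using diag_absorbs[of m k i j] diag_absorbs[of k m j i] that diag_in_D
      complex_vs.subspace_0[OF csubspace_D] by (cases "m \<le> k") auto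
  have left: "csubspace {x. x * y \<in> D}" "closed {x. x * y \<in> D}" for y
    by (auto simp: complex_vs.subspace_def distrib_right scaleC_mult_left
        complex_vs.subspace_0[OF csubspace_D] complex_vs.subspace_add[OF csubspace_D]
        complex_vs.subspace_scale[OF csubspace_D]
        intro!: continuous_closed_vimage[OF closed_D, unfolded vimage_def] continuous_intros)
  have "D \<subseteq> {x. x * e k j j \<in> D}" if "j \<in> I k" for k j
    using gen that by (intro diagonal_subset left) auto
  then have "x * e k j j \<in> D" if "j \<in> I k" "x \<in> D" for x k j
    using that by auto
  then have "e k j j * x \<in> D" if "j \<in> I k" "x \<in> D" for x k j
    using that D_commute diag_in_D by metis
  then have "D \<subseteq> {x. x * d \<in> D}"
    using assms(2) by (intro diagonal_subset left) auto
  then show ?thesis using assms(1) by auto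
qed

lemma D_star:
  assumes "d \<in> D"
  shows "star d \<in> D"
proof -
  have "D \<subseteq> {x. star x \<in> D}"
  proof (rule diagonal_subset)
    show "csubspace {x. star x \<in> D}"
      by (auto simp: complex_vs.subspace_def star_add star_scaleC
        complex_vs.subspace_0[OF csubspace_D] complex_vs.subspace_add[OF csubspace_D]
        complex_vs.subspace_scale[OF csubspace_D])
    show "closed {x. star x \<in> D}"
      by (intro continuous_closed_vimage[OF closed_D, unfolded vimage_def]
          linear_continuous_at bounded_linear_star)
  qed (simp add: star_diag diag_in_D)
  then show ?thesis using assms by auto
qed

text \<open>
  The units of the next level that add up to a matrix unit have orthogonal initial projections,
  since they form a partial bijection between indices. Hence conjugation by the unit has no cross
  terms, which makes matrix units normalize the diagonal.
\<close>

lemma unit_eq_sum_units_Suc: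
  assumes ij: "(i, j) \<in> R n"
  shows "\<exists>T\<subseteq>R (Suc n). e n i j = (\<Sum>(k, l)\<in>T. e (Suc n) k l) \<and>
    (\<forall>k k' l. (k, l) \<in> T \<longrightarrow> (k', l) \<in> T \<longrightarrow> k = k')"
proof -
  from sum_of_units[OF R_sym[OF ij]] obtain T
    where T: "T \<subseteq> R (Suc n)" and eq: "e n j i = (\<Sum>(k, l)\<in>T. e (Suc n) k l)" by blast
  from sum_of_units[OF R_refl[OF R_Field(2)[OF ij]]] obtain T'
    where T': "T' \<subseteq> R (Suc n)" and eq': "e n j j = (\<Sum>(k, l)\<in>T'. e (Suc n) k l)" by blast
  have "l = l'" if kl: "(k, l) \<in> T" "(k, l') \<in> T" for k l l'
  proof -
    from kl T have k: "k \<in> I (Suc n)" using R_Field by blast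
    have fin: "finite (T `` {k})" by (rule finite_Image[OF finite_subset[OF T finite_R]])
    have "e n j i * star (e n j i) = e n j j"
      using ij by (simp add: star_unit R_sym unit_mult)
    then have "real (card (T `` {k})) *\<^sub>R e (Suc n) k k = (if (k, k) \<in> T' then e (Suc n) k k else 0)"
      using unit_sum_gram[OF T eq k] unit_sum_compress[OF T' eq' k] by simp
    then have "card (T `` {k}) \<le> 1"
      using unit_nonzero[OF R_refl[OF k]]
        scaleR_cancel_right[of "real (card (T `` {k}))" "e (Suc n) k k" 1]
      by (auto split: if_splits)
    then show ?thesis
      using kl fin by (auto simp: card_le_Suc0_iff_eq)
  qed
  moreover have "e n i j = (\<Sum>(k, l)\<in>T\<inverse>. e (Suc n) k l)"
  proof -
    have "e n i j = star (e n j i)" using ij by (simp add: star_unit R_sym)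
    also have "\<dots> = (\<Sum>(k, l)\<in>T. e (Suc n) l k)"
      unfolding eq star_sum using T by (intro sum.cong) (auto simp: star_unit)
    also have "\<dots> = (\<Sum>(k, l)\<in>T\<inverse>. e (Suc n) k l)"
      by (rule sum.reindex_bij_witness[where i = prod.swap and j = prod.swap]) auto
    finally show ?thesis .
  qed
  moreover have "T\<inverse> \<subseteq> R (Suc n)" using T R_sym by auto
  ultimately show ?thesis
    by (intro exI[of _ "T\<inverse>"]) blast
qed

lemma conj_diag_in_D:
  assumes "n \<le> m" "(i, j) \<in> R n" "k \<in> I m"
  shows "e n i j * e m k k * e n j i \<in> D"
  using assms
proof (induction n arbitrary: i j rule: inc_induct)
  case base
  then show ?case
    using complex_vs.subspace_0[OF csubspace_D] diag_in_D[of i m]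
    by (auto simp: unit_mult R_refl R_sym R_Field)
next
  case (step n)
  let ?v = "\<lambda>t. e (Suc n) (fst t) (snd t)" and ?d = "e m k k"
  from unit_eq_sum_units_Suc[OF step.prems(1)] obtain T
    where T: "T \<subseteq> R (Suc n)" and eq: "e n i j = (\<Sum>(k, l)\<in>T. e (Suc n) k l)"
      and inj: "\<And>k k' l. (k, l) \<in> T \<Longrightarrow> (k', l) \<in> T \<Longrightarrow> k = k'" by blast
  have fin: "finite T" using T by (rule finite_subset) (rule finite_R)
  have eq1: "e n i j = sum ?v T" using eq by (simp add: case_prod_beta)
  have eq2: "e n j i = (\<Sum>t\<in>T. star (?v t))"
    using step.prems(1) by (simp add: star_unit[symmetric] eq1 star_sum)
  \<comment> \<open>The diagonal unit \<open>?d\<close> commutes with the initial projections, so it cannot link two orthogonal ones.\<close>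
  have off: "?v t * ?d * star (?v s) = 0" if "t \<in> T" "s \<in> T" "t \<noteq> s" for t s
  proof -
    obtain a b a' b' where ts: "t = (a, b)" "s = (a', b')" by fastforce
    have R: "(a, b) \<in> R (Suc n)" "(a', b') \<in> R (Suc n)" using that ts T by auto
    then have b: "b \<in> I (Suc n)" "b' \<in> I (Suc n)" by (auto simp: R_Field)
    have ne: "b \<noteq> b'" using inj that ts by blast
    have com: "e (Suc n) b b * ?d = ?d * e (Suc n) b b"
      using b step.prems(2) by (intro D_commute diag_in_D)
    have "?v t * ?d * star (?v s)
        = e (Suc n) a b * (e (Suc n) b b * ?d) * (e (Suc n) b' b' * e (Suc n) b' a')"
      using R b by (simp add: ts star_unit unit_mult R_refl R_sym mult.assoc[symmetric])
    also have "\<dots> = e (Suc n) a b * ?d * (e (Suc n) b b * e (Suc n) b' b') * e (Suc n) b' a'"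
      unfolding com by (simp only: mult.assoc)
    also have "\<dots> = 0" using b ne by (simp add: diag_mult)
    finally show ?thesis .
  qed
  have "e n i j * ?d * e n j i = (\<Sum>t\<in>T. \<Sum>s\<in>T. ?v t * ?d * star (?v s))"
    unfolding eq1 eq2 sum_distrib_right[of ?v T ?d] sum_product ..
  also have "\<dots> = (\<Sum>t\<in>T. \<Sum>s\<in>T. if s = t then ?v t * ?d * star (?v t) else 0)"
    using off by (intro sum.cong) auto
  also have "\<dots> = (\<Sum>t\<in>T. ?v t * ?d * star (?v t))"
    using fin by simp
  also have "\<dots> \<in> D"
  proof (rule complex_vs.subspace_sum[OF csubspace_D])
    fix t assume "t \<in> T"
    then have R: "(fst t, snd t) \<in> R (Suc n)" using T by auto
    then show "?v t * ?d * star (?v t) \<in> D"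
      using step.IH[OF R step.prems(2)] by (simp add: star_unit)
  qed
  finally show ?case .
qed

lemma conj_in_D:
  assumes ij: "(i, j) \<in> R n" and d: "d \<in> D"
  shows "e n i j * d * e n j i \<in> D"
proof -
  have "D \<subseteq> {x. e n i j * x * e n j i \<in> D}"
  proof (rule diagonal_subset[where n = n])
    show "csubspace {x. e n i j * x * e n j i \<in> D}"
      by (auto simp: complex_vs.subspace_def distrib_right distrib_left scaleC_mult_left scaleC_mult_right
        complex_vs.subspace_0[OF csubspace_D] complex_vs.subspace_add[OF csubspace_D]
        complex_vs.subspace_scale[OF csubspace_D])
    show "closed {x. e n i j * x * e n j i \<in> D}"
      by (intro continuous_closed_vimage[OF closed_D, unfolded vimage_def] continuous_intros)
  qed (simp add: conj_diag_in_D[OF _ ij])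
  then show ?thesis using d by auto
qed

section \<open>The conditional expectation\<close>

text \<open>
  The sequence whose limit is the conditional expectation.
\<close>

definition pinch :: "nat \<Rightarrow> 'a \<Rightarrow> 'a" where
  "pinch n f = (\<Sum>i\<in>I n. e n i i * f * e n i i)"

abbreviation \<pi> :: "'a \<Rightarrow> 'a" where "\<pi> \<equiv> cond_exp R e"

lemma norm_diag_le: "i \<in> I n \<Longrightarrow> norm (e n i i) \<le> 1"
  by (rule norm_projection_le) (simp_all add: star_diag diag_mult)

text \<open>
  The blocks may come from different elements \<open>f i\<close>; this freedom is needed in
  \<open>norm_\<pi>_mult_diff_le\<close>, where the compressed element varies with the block.
\<close>

lemma norm_compress_sum_le:
  assumes "\<And>i. i \<in> I n \<Longrightarrow> norm (e n i i * f i * e n i i) \<le> c" "0 \<le> c"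
  shows "norm (\<Sum>i\<in>I n. e n i i * f i * e n i i) \<le> c"
proof (rule norm_orthogonal_sum_le)
  fix i j assume ij: "i \<in> I n" "j \<in> I n" "i \<noteq> j"
  then have "e n i i * (e n j j * x) = 0" for x
    by (metis diag_mult mult.assoc mult_zero_left)
  then show "star (e n i i * f i * e n i i) * (e n j j * f j * e n j j) = 0"
    "e n i i * f i * e n i i * star (e n j j * f j * e n j j) = 0"
    using ij by (simp_all add: star_mult star_diag mult.assoc)
qed (use assms in auto)

lemma norm_pinch_le: "norm (pinch n f) \<le> norm f"
  unfolding pinch_def
proof (rule norm_compress_sum_le)
  fix i assume i: "i \<in> I n"
  have "norm (e n i i * f * e n i i) \<le> norm (e n i i) * norm f * norm (e n i i)"
    by (intro order.trans[OF norm_mult_ineq] mult_right_mono norm_mult_ineq) simp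
  also have "\<dots> \<le> 1 * norm f * 1"
    using norm_diag_le[OF i] by (intro mult_mono) auto
  finally show "norm (e n i i * f * e n i i) \<le> norm f" by simp
qed simp

lemma pinch_add: "pinch n (f + g) = pinch n f + pinch n g"
  and pinch_diff: "pinch n (f - g) = pinch n f - pinch n g"
  and pinch_scaleC: "pinch n (c *\<^sub>C f) = c *\<^sub>C pinch n f"
  by (simp_all add: pinch_def algebra_simps sum.distrib sum_subtractf scaleC_mult_left
      scaleC_mult_right scaleC_sum)

lemma unit_absorb: "(i, j) \<in> R n \<Longrightarrow> e n i j = e n i i * e n i j * e n j j"
  by (simp add: unit_mult R_refl R_Field)

lemma diag_compress_unit:
  assumes "n \<le> m" "(i, j) \<in> R n" and k: "k \<in> I m"
  shows "e m k k * e n i j * e m k k = (if i = j then e n i i * e m k k else 0)"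
proof (cases "i = j")
  case True
  then show ?thesis
    using diag_absorbs[OF assms(1) R_Field(1)[OF assms(2)] k] k
    by (auto simp: diag_mult mult.assoc)
next
  case False
  have "e m k k * e n i j * e m k k = (e m k k * e n i i) * e n i j * (e n j j * e m k k)"
    by (subst unit_absorb[OF assms(2)]) (simp only: mult.assoc)
  moreover have "e m k k * e n i i = 0 \<or> e n j j * e m k k = 0"
  proof (rule ccontr)
    assume "\<not> ?thesis"
    then have "e m k k * e n i i = e m k k" "e n j j * e m k k = e m k k"
      using diag_absorbs[OF assms(1) _ k] R_Field[OF assms(2)] by metis+
    then have "e m k k = (e m k k * e n i i) * (e n j j * e m k k)"
      using k by (simp add: diag_mult)
    also have "\<dots> = e m k k * (e n i i * e n j j) * e m k k"
      by (simp only: mult.assoc)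
    also have "\<dots> = 0" using False R_Field[OF assms(2)] by (simp add: diag_mult)
    finally show False using unit_nonzero[OF R_refl[OF k]] by simp
  qed
  ultimately show ?thesis using False by auto
qed

lemma pinch_unit:
  assumes "n \<le> m" "(i, j) \<in> R n"
  shows "pinch m (e n i j) = (if i = j then e n i i else 0)"
proof (cases "i = j")
  case True
  then have "pinch m (e n i j) = e n i i * (\<Sum>k\<in>I m. e m k k)"
    using diag_compress_unit[OF assms] by (simp add: pinch_def sum_distrib_left)
  then show ?thesis using True by (simp add: sum_diag)
next
  case False
  then show ?thesis using diag_compress_unit[OF assms] by (simp add: pinch_def)
qed

text \<open>
  On a matrix unit the sequence is eventually constant, and the maps \<open>pinch m\<close> are contractions, so
  convergence passes to norm limits.
\<close>

lemma convergent_pinch: "convergent (\<lambda>m. pinch m f)"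
proof -
  let ?V = "{f. convergent (\<lambda>m. pinch m f)}"
  have "f \<in> ?V"
  proof (rule algebra_subset)
    show "csubspace ?V"
      unfolding complex_vs.subspace_def
    proof (intro conjI allI ballI)
      fix c x assume "x \<in> ?V"
      then show "c *\<^sub>C x \<in> ?V"
        unfolding convergent_def mem_Collect_eq pinch_scaleC
        using bounded_linear.tendsto[OF bounded_linear_scaleC] by blast
    qed (auto simp: pinch_add convergent_add, simp add: pinch_def convergent_const)
    show "closed ?V"
      unfolding closed_sequential_limits
    proof (intro allI impI, elim conjE)
      fix g :: "nat \<Rightarrow> 'a" and l
      assume g: "\<forall>n. g n \<in> ?V" and lim: "g \<longlonglongrightarrow> l"
      have "Cauchy (\<lambda>m. pinch m l)"
      proof (rule metric_CauchyI)
        fix \<epsilon> :: real assume \<epsilon>: "0 < \<epsilon>"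
        from LIMSEQ_D[OF lim, of "\<epsilon> / 3"] \<epsilon> obtain k where k: "norm (l - g k) < \<epsilon> / 3"
          by (auto simp: norm_minus_commute)
        have "Cauchy (\<lambda>m. pinch m (g k))" using g by (auto intro: convergent_Cauchy)
        then obtain M where M: "\<And>m n. m \<ge> M \<Longrightarrow> n \<ge> M \<Longrightarrow> norm (pinch m (g k) - pinch n (g k)) < \<epsilon> / 3"
          using CauchyD[of _ "\<epsilon> / 3"] \<epsilon> by fastforce
        have "dist (pinch m l) (pinch n l) < \<epsilon>" if "m \<ge> M" "n \<ge> M" for m n
        proof -
          have eq: "pinch m l - pinch n l =
              pinch m (l - g k) + (pinch m (g k) - pinch n (g k)) - pinch n (l - g k)"
            by (simp add: pinch_diff)
          have "norm (pinch m l - pinch n l) \<le>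
              norm (pinch m (l - g k)) + norm (pinch m (g k) - pinch n (g k)) + norm (pinch n (l - g k))"
            unfolding eq
            using norm_triangle_ineq[of "pinch m (l - g k)" "pinch m (g k) - pinch n (g k)"]
              norm_triangle_ineq4[of "pinch m (l - g k) + (pinch m (g k) - pinch n (g k))" "pinch n (l - g k)"]
            by linarith
          also have "\<dots> < \<epsilon>"
            using norm_pinch_le[of m "l - g k"] norm_pinch_le[of n "l - g k"] M[OF that] k by linarith
          finally show ?thesis by (simp add: dist_norm)
        qed
        then show "\<exists>M. \<forall>m\<ge>M. \<forall>n\<ge>M. dist (pinch m l) (pinch n l) < \<epsilon>" by blast
      qed
      then show "l \<in> ?V" by (simp add: Cauchy_convergent)
    qed
  next
    fix n i j assume ij: "(i, j) \<in> R n"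
    have "(\<lambda>m. pinch m (e n i j)) \<longlonglongrightarrow> (if i = j then e n i i else 0)"
      by (rule tendsto_eventually, rule eventually_sequentiallyI[of n]) (rule pinch_unit[OF _ ij])
    then show "e n i j \<in> ?V" by (auto simp: convergent_def)
  qed
  then show ?thesis by simp
qed

lemma pinch_tendsto: "(\<lambda>m. pinch m f) \<longlonglongrightarrow> \<pi> f"
  using convergent_pinch[of f] unfolding cond_exp_def pinch_def convergent_LIMSEQ_iff .

lemma \<pi>_unit: "(i, j) \<in> R n \<Longrightarrow> \<pi> (e n i j) = (if i = j then e n i i else 0)"
  by (rule LIMSEQ_unique[OF pinch_tendsto], rule tendsto_eventually,
      rule eventually_sequentiallyI[of n]) (rule pinch_unit)

lemma \<pi>_scaleC: "\<pi> (c *\<^sub>C f) = c *\<^sub>C \<pi> f"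
  using LIMSEQ_unique[OF pinch_tendsto[of "c *\<^sub>C f"]]
    bounded_linear.tendsto[OF bounded_linear_scaleC pinch_tendsto] by (simp add: pinch_scaleC)

lemma bounded_linear_\<pi>: "bounded_linear \<pi>"
proof (rule bounded_linear_intro[of _ 1])
  show "\<pi> (f + g) = \<pi> f + \<pi> g" for f g
    using LIMSEQ_unique[OF pinch_tendsto[of "f + g"]] tendsto_add[OF pinch_tendsto pinch_tendsto]
    by (simp add: pinch_add)
  show "\<pi> (r *\<^sub>R f) = r *\<^sub>R \<pi> f" for r f
    using \<pi>_scaleC[of "complex_of_real r" f] by (simp add: scaleC_of_real)
  show "norm (\<pi> f) \<le> norm f * 1" for f
    using LIMSEQ_le_const2[OF tendsto_norm[OF pinch_tendsto]] norm_pinch_le by simp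
qed

lemmas \<pi>_add = linear_add[OF bounded_linear.linear[OF bounded_linear_\<pi>]]
lemmas \<pi>_diff = linear_diff[OF bounded_linear.linear[OF bounded_linear_\<pi>]]
lemmas \<pi>_zero = linear_0[OF bounded_linear.linear[OF bounded_linear_\<pi>]]

lemma closed_\<pi>_vimage: "closed V \<Longrightarrow> closed {f. \<pi> f \<in> V}"
  by (intro continuous_closed_vimage[unfolded vimage_def] linear_continuous_at bounded_linear_\<pi>)

lemma \<pi>_in_D: "\<pi> f \<in> D"
proof -
  have "f \<in> {f. \<pi> f \<in> D}"
  proof (rule algebra_subset)
    show "csubspace {f. \<pi> f \<in> D}"
      by (auto simp: complex_vs.subspace_def \<pi>_add \<pi>_zero \<pi>_scaleC
        complex_vs.subspace_0[OF csubspace_D] complex_vs.subspace_add[OF csubspace_D]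
        complex_vs.subspace_scale[OF csubspace_D])
  qed (auto simp: closed_\<pi>_vimage closed_D \<pi>_unit diag_in_D R_Field
      complex_vs.subspace_0[OF csubspace_D])
  then show ?thesis by simp
qed

lemma pinch_diag_mult:
  assumes "n \<le> m" "i \<in> I n"
  shows "pinch m (e n i i * f) = e n i i * pinch m f" "pinch m (f * e n i i) = pinch m f * e n i i"
proof -
  have com: "e m k k * e n i i = e n i i * e m k k" if "k \<in> I m" for k
    using diag_absorbs[OF assms that] by auto
  show "pinch m (e n i i * f) = e n i i * pinch m f"
    unfolding pinch_def sum_distrib_left
    by (intro sum.cong refl) (simp add: mult.assoc[symmetric] com)
  show "pinch m (f * e n i i) = pinch m f * e n i i"
    unfolding pinch_def sum_distrib_right
    by (intro sum.cong refl) (simp add: mult.assoc com)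
qed

lemma \<pi>_D_mult:
  assumes d: "d \<in> D"
  shows "\<pi> (d * f) = d * \<pi> f" "\<pi> (f * d) = \<pi> f * d"
proof -
  have diag: "\<pi> (e n i i * f) = e n i i * \<pi> f" "\<pi> (f * e n i i) = \<pi> f * e n i i"
    if i: "i \<in> I n" for n i
  proof -
    have "(\<lambda>m. pinch m (e n i i * f)) \<longlonglongrightarrow> e n i i * \<pi> f"
      by (rule Lim_transform_eventually[OF tendsto_mult_left[OF pinch_tendsto]],
          rule eventually_sequentiallyI[of n]) (simp add: pinch_diag_mult i)
    then show "\<pi> (e n i i * f) = e n i i * \<pi> f" using LIMSEQ_unique pinch_tendsto by blast
    have "(\<lambda>m. pinch m (f * e n i i)) \<longlonglongrightarrow> \<pi> f * e n i i"
      by (rule Lim_transform_eventually[OF tendsto_mult_right[OF pinch_tendsto]],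
          rule eventually_sequentiallyI[of n]) (simp add: pinch_diag_mult i)
    then show "\<pi> (f * e n i i) = \<pi> f * e n i i" using LIMSEQ_unique pinch_tendsto by blast
  qed
  note cont = continuous_on_mult continuous_on_const continuous_on_id
    bounded_linear.continuous_on[OF bounded_linear_\<pi>]
  have "D \<subseteq> {d. \<pi> (d * f) = d * \<pi> f}"
  proof (rule diagonal_subset)
    show "csubspace {d. \<pi> (d * f) = d * \<pi> f}"
      by (auto simp: complex_vs.subspace_def \<pi>_add \<pi>_zero \<pi>_scaleC distrib_right scaleC_mult_left)
    show "closed {d. \<pi> (d * f) = d * \<pi> f}"
      by (intro closed_Collect_eq cont)
  qed (simp add: diag)
  then show "\<pi> (d * f) = d * \<pi> f" using d by auto
  have "D \<subseteq> {d. \<pi> (f * d) = \<pi> f * d}"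
  proof (rule diagonal_subset)
    show "csubspace {d. \<pi> (f * d) = \<pi> f * d}"
      by (auto simp: complex_vs.subspace_def \<pi>_add \<pi>_zero \<pi>_scaleC distrib_left scaleC_mult_right)
    show "closed {d. \<pi> (f * d) = \<pi> f * d}"
      by (intro closed_Collect_eq cont)
  qed (simp add: diag)
  then show "\<pi> (f * d) = \<pi> f * d" using d by auto
qed

lemma \<pi>_one: "\<pi> 1 = 1"
proof -
  have "pinch n 1 = 1" for n
    by (simp add: pinch_def diag_mult sum_diag)
  then show ?thesis using LIMSEQ_unique[OF pinch_tendsto[of 1]] by simp
qed

lemma \<pi>_D: "d \<in> D \<Longrightarrow> \<pi> d = d"
  using \<pi>_D_mult(1)[of d 1] by (simp add: \<pi>_one)

section \<open>The conditional expectation of a product\<close>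

text \<open>
  Let \<open>p\<close> be a minimal diagonal projection of a later level, lying below \<open>e n i i\<close>. The projection
  \<open>row_support n p\<close> is the sum of the copies of \<open>p\<close> below the \<open>e n j j\<close> with \<open>j\<close> equivalent to
  \<open>i\<close>. For general \<open>f\<close>, multiplying the row \<open>p * f\<close> by it compresses the entries of that row to \<open>p\<close>, the
  result being \<open>\<Sum>j. (p * f * e n j i * p) * e n i j\<close>; for \<open>f\<close> in \<open>B n\<close> the row does not change.
\<close>

definition row_support :: "nat \<Rightarrow> 'a \<Rightarrow> 'a" where
  "row_support n p = (\<Sum>(i, j)\<in>R n. e n j i * p * e n i j)"

lemma row_support_projection:
  assumes nm: "n \<le> m" and k: "k \<in> I m"
  defines "p \<equiv> e m k k"
  shows "star (row_support n p) = row_support n p"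
    and "row_support n p * row_support n p = row_support n p"
proof -
  let ?v = "\<lambda>t. e n (snd t) (fst t) * p * e n (fst t) (snd t)"
  have q: "row_support n p = sum ?v (R n)"
    by (simp add: row_support_def case_prod_beta)
  have "star (?v t) = ?v t" if "t \<in> R n" for t
  proof -
    have "(fst t, snd t) \<in> R n" using that by simp
    then show ?thesis
      using k by (simp add: p_def star_mult star_unit R_sym R_refl mult.assoc)
  qed
  then show "star (row_support n p) = row_support n p"
    unfolding q star_sum by (intro sum.cong) auto
  have mult: "?v t * ?v s = (if s = t then ?v t else 0)" if "t \<in> R n" "s \<in> R n" for t s
  proof -
    obtain i j i' j' where ts: "t = (i, j)" "s = (i', j')" by fastforce
    have R: "(i, j) \<in> R n" "(i', j') \<in> R n" using that ts by auto
    have "?v t * ?v s = e n j i * p * (e n i j * e n j' i') * p * e n i' j'"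
      by (simp add: ts mult.assoc)
    also have "\<dots> = (if s = t then ?v t else 0)"
    proof (cases "j = j'")
      case True
      then have "(i, i') \<in> R n" using R R_trans R_sym by blast
      have "e n j i * p * (e n i j * e n j' i') * p * e n i' j'
          = e n j i * (p * e n i i' * p) * e n i' j'"
        using R True by (simp add: unit_mult R_sym mult.assoc)
      also have "\<dots> = e n j i * (if i = i' then e n i i * p else 0) * e n i' j'"
        unfolding p_def diag_compress_unit[OF nm \<open>(i, i') \<in> R n\<close> k] ..
      also have "\<dots> = (if s = t then ?v t else 0)"
        using True R by (auto simp: ts mult.assoc[symmetric] unit_mult R_sym R_refl R_Field)
      finally show ?thesis .
    next
      case False
      then show ?thesis using R by (simp add: ts unit_mult R_sym)
    qed
    finally show ?thesis .
  qed
  have "row_support n p * row_support n p = (\<Sum>t\<in>R n. \<Sum>s\<in>R n. ?v t * ?v s)"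
    unfolding q by (rule sum_product)
  also have "\<dots> = (\<Sum>t\<in>R n. \<Sum>s\<in>R n. if s = t then ?v t else 0)"
    using mult by (intro sum.cong) auto
  also have "\<dots> = row_support n p"
    using finite_R by (simp add: q)
  finally show "row_support n p * row_support n p = row_support n p" .
qed

lemma mult_row_support:
  assumes nm: "n \<le> m" and k: "k \<in> I m" and f: "f \<in> B n"
  shows "e m k k * f * row_support n (e m k k) = e m k k * f"
proof -
  let ?p = "e m k k"
  have "B n \<subseteq> {f. ?p * f * row_support n ?p = ?p * f}"
    unfolding B_eq
  proof (rule complex_vs.span_minimal)
    show "csubspace {f. ?p * f * row_support n ?p = ?p * f}"
      by (auto simp: complex_vs.subspace_def distrib_left distrib_right scaleC_mult_left scaleC_mult_right)
    have "?p * e n a b * row_support n ?p = ?p * e n a b" if ab: "(a, b) \<in> R n" for a b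
    proof -
      have term_eq: "?p * e n a b * (e n j i * ?p * e n i j) = (if (a, b) = (i, j) then ?p * e n a b else 0)"
        if ij: "(i, j) \<in> R n" for i j
      proof (cases "b = j")
        case True
        then have ai: "(a, i) \<in> R n" using ab ij R_trans R_sym by blast
        have "?p * e n a b * (e n j i * ?p * e n i j) = ?p * (e n a b * e n j i) * ?p * e n i j"
          by (simp only: mult.assoc)
        also have "\<dots> = (if a = i then e n a a * ?p else 0) * e n i j"
          using True diag_compress_unit[OF nm ai k] ab ij by (simp add: unit_mult R_sym)
        also have "\<dots> = (if (a, b) = (i, j) then ?p * e n a b else 0)"
        proof (cases "a = i")
          case True
          have "e n a a * ?p = ?p * e n a a"
            using ab k by (intro D_commute diag_in_D) (auto simp: R_Field)
          then show ?thesis using True \<open>b = j\<close> ab by (simp add: mult.assoc unit_mult R_refl R_Field)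
        qed simp
        finally show ?thesis .
      next
        case False
        have "?p * e n a b * (e n j i * ?p * e n i j) = ?p * (e n a b * e n j i) * ?p * e n i j"
          by (simp only: mult.assoc)
        then show ?thesis using False ab ij by (simp add: unit_mult R_sym)
      qed
      have "?p * e n a b * row_support n ?p
          = (\<Sum>t\<in>R n. ?p * e n a b * (e n (snd t) (fst t) * ?p * e n (fst t) (snd t)))"
        by (simp add: row_support_def case_prod_beta sum_distrib_left)
      also have "\<dots> = (\<Sum>t\<in>R n. if (a, b) = t then ?p * e n a b else 0)"
        using term_eq by (intro sum.cong refl) force
      also have "\<dots> = ?p * e n a b"
        using finite_R ab by simp
      finally show ?thesis .
    qed
    then show "{e n i j |i j. (i, j) \<in> R n} \<subseteq> {f. ?p * f * row_support n ?p = ?p * f}"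
      by auto
  qed
  then show ?thesis using f by auto
qed

lemma pinch_mult: "pinch m f * pinch m g = (\<Sum>k\<in>I m. e m k k * (f * e m k k * g) * e m k k)"
proof -
  have "pinch m f * pinch m g
      = (\<Sum>k\<in>I m. \<Sum>l\<in>I m. (e m k k * f * e m k k) * (e m l l * g * e m l l))"
    unfolding pinch_def by (rule sum_product)
  also have "\<dots> = (\<Sum>k\<in>I m. \<Sum>l\<in>I m. if l = k then e m k k * (f * e m k k * g) * e m k k else 0)"
  proof (intro sum.cong refl)
    fix k l assume "k \<in> I m" "l \<in> I m"
    have "(e m k k * f * e m k k) * (e m l l * g * e m l l)
        = e m k k * f * (e m k k * e m l l) * g * e m l l"
      by (simp only: mult.assoc)
    then show "(e m k k * f * e m k k) * (e m l l * g * e m l l)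
        = (if l = k then e m k k * (f * e m k k * g) * e m k k else 0)"
      using \<open>k \<in> I m\<close> \<open>l \<in> I m\<close> by (simp add: diag_mult mult.assoc)
  qed
  finally show ?thesis by simp
qed

text \<open>
  The coordinate formula \<open>(f b)(x,x) = \<Sum>u. f(x,u) b(u,x)\<close>, with the sum cut off at level \<open>n\<close>, and its
  error. The bound must not involve the number of matrix units, because \<open>n\<close> grows as \<open>f'\<close>
  approaches \<open>f\<close>. This works because, after compression to a small diagonal projection \<open>p\<close>, the
  cut off sum is \<open>p * f * q * b * p\<close> with the projection \<open>q = row_support n p\<close>; so the error is
  \<open>p * f * (1 - q) * b * p\<close>, in which \<open>f\<close> may be replaced by \<open>f - f'\<close>. Different \<open>p\<close> give orthogonal
  blocks, whose norms do not add up.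
\<close>

lemma norm_\<pi>_mult_diff_le:
  assumes f': "f' \<in> B n"
  shows "norm (\<pi> (f * b) - (\<Sum>(i, j)\<in>R n. \<pi> (f * e n j i) * \<pi> (e n i j * b)))
    \<le> norm (f - f') * norm b"
proof (rule LIMSEQ_le_const2)
  show "(\<lambda>m. norm (pinch m (f * b) - (\<Sum>(i, j)\<in>R n. pinch m (f * e n j i) * pinch m (e n i j * b))))
    \<longlonglongrightarrow> norm (\<pi> (f * b) - (\<Sum>(i, j)\<in>R n. \<pi> (f * e n j i) * \<pi> (e n i j * b)))"
    unfolding case_prod_beta
    by (intro tendsto_norm tendsto_diff tendsto_sum tendsto_mult pinch_tendsto)
  have "norm (pinch m (f * b) - (\<Sum>(i, j)\<in>R n. pinch m (f * e n j i) * pinch m (e n i j * b)))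
      \<le> norm (f - f') * norm b" if nm: "n \<le> m" for m
  proof -
    let ?q = "\<lambda>k. row_support n (e m k k)"
    have "(\<Sum>(i, j)\<in>R n. pinch m (f * e n j i) * pinch m (e n i j * b))
        = (\<Sum>k\<in>I m. \<Sum>t\<in>R n. e m k k * (f * (e n (snd t) (fst t) * e m k k * e n (fst t) (snd t)) * b) * e m k k)"
      unfolding pinch_mult case_prod_beta by (subst sum.swap) (simp only: mult.assoc)
    also have "\<dots> = (\<Sum>k\<in>I m. e m k k * (f * ?q k * b) * e m k k)"
      by (simp add: row_support_def case_prod_beta sum_distrib_left sum_distrib_right)
    finally have "pinch m (f * b) - (\<Sum>(i, j)\<in>R n. pinch m (f * e n j i) * pinch m (e n i j * b))
        = (\<Sum>k\<in>I m. e m k k * (f * (1 - ?q k) * b) * e m k k)"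
      by (simp add: pinch_def sum_subtractf[symmetric] algebra_simps)
    also have "norm \<dots> \<le> norm (f - f') * norm b"
    proof (rule norm_compress_sum_le)
      fix k assume k: "k \<in> I m"
      note q = row_support_projection[OF nm k]
      have "norm (1 - ?q k) \<le> 1"
        by (rule norm_projection_le)
          (use q in \<open>simp_all add: algebra_simps linear_diff[OF bounded_linear.linear[OF bounded_linear_star]]\<close>)
      \<comment> \<open>This is what allows \<open>f\<close> to be replaced by \<open>f - f'\<close>.\<close>
      have zero: "e m k k * f' * (1 - ?q k) = 0"
        using mult_row_support[OF nm k f'] by (simp add: right_diff_distrib)
      have "e m k k * (f * (1 - ?q k) * b) * e m k k
          = e m k k * ((f - f') * (1 - ?q k) * b) * e m k k
            + (e m k k * f' * (1 - ?q k)) * b * e m k k"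
        by (simp add: algebra_simps)
      then have "e m k k * (f * (1 - ?q k) * b) * e m k k
          = e m k k * ((f - f') * (1 - ?q k) * b) * e m k k"
        by (simp add: zero)
      also have "norm \<dots> \<le> norm (e m k k) * (norm (f - f') * norm (1 - ?q k) * norm b) * norm (e m k k)"
        by (intro order.trans[OF norm_mult_ineq] mult_mono norm_mult_ineq mult_nonneg_nonneg) simp_all
      also have "\<dots> \<le> 1 * (norm (f - f') * 1 * norm b) * 1"
        using norm_diag_le[OF k] \<open>norm (1 - ?q k) \<le> 1\<close> by (intro mult_mono mult_nonneg_nonneg) simp_all
      finally show "norm (e m k k * (f * (1 - ?q k) * b) * e m k k) \<le> norm (f - f') * norm b" by simp
    qed simp
    finally show ?thesis .
  qed
  then show "\<exists>N. \<forall>m\<ge>N. norm (pinch m (f * b) - (\<Sum>(i, j)\<in>R n. pinch m (f * e n j i) * pinch m (e n i j * b)))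
      \<le> norm (f - f') * norm b"
    by blast
qed

section \<open>Triangular subalgebras\<close>

context
  fixes A :: "'a set"
  assumes triangular: "triangular D A" and closed_A: "closed A"
begin

lemma csubspace_A: "csubspace A"
  and A_mult: "x \<in> A \<Longrightarrow> y \<in> A \<Longrightarrow> x * y \<in> A"
  and D_subset_A: "D \<subseteq> A"
  using triangular by (auto simp: triangular_def csubalgebra_def)

lemma mem_D_if_star_mem: "x \<in> A \<Longrightarrow> star x \<in> A \<Longrightarrow> x \<in> D"
  using triangular unfolding triangular_def by (metis IntI imageI star_star)

lemma D_in_A: "d \<in> D \<Longrightarrow> d \<in> A"
  using D_subset_A by blast

text \<open>
  For a closed \<open>\<D>\<close>-bimodule this is the component of \<open>f\<close> along the graph of the unit \<open>e n i j\<close>; it stays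
  in the bimodule because it is a limit of sums \<open>\<Sum>k. e m k k * f * d k\<close> with
  \<open>d k = e n j i * e m k k * e n i j\<close> in \<open>\<D>\<close>.
\<close>

lemma \<pi>_mult_unit_in_A:
  assumes f: "f \<in> A" and ij: "(i, j) \<in> R n"
  shows "\<pi> (f * e n j i) * e n i j \<in> A"
proof (rule closed_sequentially[OF closed_A])
  show "(\<lambda>m. pinch m (f * e n j i) * e n i j) \<longlonglongrightarrow> \<pi> (f * e n j i) * e n i j"
    by (intro tendsto_mult pinch_tendsto tendsto_const)
  fix m
  have "e m k k * f * (e n j i * e m k k * e n i j) \<in> A" if "k \<in> I m" for k
  proof (rule A_mult[OF A_mult[OF _ f]])
    show "e m k k \<in> A" "e n j i * e m k k * e n i j \<in> A"
      using diag_in_D[OF that] by (auto intro: D_in_A conj_in_D[OF R_sym[OF ij]])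
  qed
  then show "pinch m (f * e n j i) * e n i j \<in> A"
    unfolding pinch_def sum_distrib_right
    by (intro complex_vs.subspace_sum[OF csubspace_A]) (simp add: mult.assoc)
qed

lemma unit_mult_\<pi>_in_A:
  assumes b: "b \<in> A" and ij: "(i, j) \<in> R n"
  shows "e n j i * \<pi> (e n i j * b) \<in> A"
proof (rule closed_sequentially[OF closed_A])
  show "(\<lambda>m. e n j i * pinch m (e n i j * b)) \<longlonglongrightarrow> e n j i * \<pi> (e n i j * b)"
    by (intro tendsto_mult pinch_tendsto tendsto_const)
  fix m
  have "(e n j i * e m k k * e n i j) * b * e m k k \<in> A" if "k \<in> I m" for k
  proof (rule A_mult[OF A_mult[OF _ b]])
    show "e m k k \<in> A" "e n j i * e m k k * e n i j \<in> A"
      using diag_in_D[OF that] by (auto intro: D_in_A conj_in_D[OF R_sym[OF ij]])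
  qed
  then show "e n j i * pinch m (e n i j * b) \<in> A"
    unfolding pinch_def sum_distrib_left
    by (intro complex_vs.subspace_sum[OF csubspace_A]) (simp add: mult.assoc)
qed

text \<open>
  Antisymmetry of \<open>spec(\<A>)\<close> in algebraic form: off the diagonal, \<open>f(x,u)\<close> and \<open>b(u,x)\<close> cannot
  both be nonzero. With \<open>d\<close> and \<open>g\<close> the two functions in \<open>\<D>\<close> and \<open>u\<close> the matrix unit, \<open>d * u\<close> and
  \<open>star u * g\<close> belong to \<open>\<A>\<close>. Multiplying them by suitable elements of \<open>\<D>\<close> gives
  \<open>x = g * star g * star d * d * u\<close> and its adjoint, so \<open>x\<close> lies in \<open>\<A> \<inter> \<A>\<^sup>* = \<D>\<close>. But \<open>x\<close> is supported off
  the diagonal; so \<open>x = 0\<close>, which says that \<open>\<bar>d * g\<bar>\<^sup>2\<close> vanishes.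
\<close>

lemma offdiagonal_coefficients_disjoint:
  assumes f: "f \<in> A" and b: "b \<in> A" and ij: "(i, j) \<in> R n" and ne: "i \<noteq> j"
  shows "\<pi> (f * e n j i) * \<pi> (e n i j * b) = 0"
proof -
  define d where "d = \<pi> (f * e n j i)"
  define g where "g = \<pi> (e n i j * b)"
  define u where "u = e n i j"
  have D: "d \<in> D" "g \<in> D" "star d \<in> D" "star g \<in> D"
    by (simp_all add: d_def g_def \<pi>_in_D D_star)
  have diag: "e n i i \<in> D" "e n j j \<in> D" using ij by (auto intro: diag_in_D simp: R_Field)
  have su: "star u = e n j i" using ij by (simp add: u_def star_unit)
  have u: "e n i i * u = u" "u * e n j j = u" "u * star u = e n i i"
    using ij by (simp_all add: u_def star_unit unit_mult R_refl R_sym R_Field)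
  have d_e: "d * e n i i = d"
    using ij \<pi>_D_mult(2)[OF diag(1), of "f * e n j i"]
    by (simp add: d_def mult.assoc unit_mult R_refl R_sym R_Field)
  define x where "x = g * star g * star d * d * u"
  have "x \<in> A"
    using A_mult[OF D_in_A[OF D_mult[OF D_mult[OF D(2) D(4)] D(3)]] \<pi>_mult_unit_in_A[OF f ij]]
    by (simp add: x_def d_def u_def mult.assoc)
  moreover have "star x \<in> A"
  proof -
    have "star x = star u * (star d * d * (g * star g))"
      by (simp add: x_def star_mult star_star mult.assoc)
    also have "star d * d * (g * star g) = g * star g * (star d * d)"
      using D by (intro D_commute D_mult)
    also have "star u * (g * star g * (star d * d)) = (star u * g) * (star g * (star d * d))"
      by (simp only: mult.assoc)
    finally have "star x = (star u * g) * (star g * (star d * d))" .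
    moreover have "star u * g \<in> A" using unit_mult_\<pi>_in_A[OF b ij] by (simp add: su g_def)
    moreover have "star g * (star d * d) \<in> A" by (intro D_in_A D_mult D)
    ultimately show ?thesis by (simp add: A_mult)
  qed
  ultimately have "x \<in> D" by (rule mem_D_if_star_mem)
  have "e n i i * x = x"
  proof -
    have "e n i i * x = (e n i i * (g * star g * star d * d)) * u" by (simp add: x_def mult.assoc)
    also have "e n i i * (g * star g * star d * d) = g * star g * star d * d * e n i i"
      using D diag by (intro D_commute D_mult)
    also have "\<dots> * u = x" by (simp add: x_def mult.assoc u)
    finally show ?thesis .
  qed
  moreover have "x * e n j j = x" by (simp add: x_def mult.assoc u)
  moreover have "e n i i * x * e n j j = x * (e n i i * e n j j)"
    using D_commute[OF diag(1) \<open>x \<in> D\<close>] by (simp add: mult.assoc)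
  ultimately have "x = 0" using ij ne by (simp add: diag_mult R_Field)
  then have "x * star u = 0" by simp
  then have "g * star g * star d * d = 0"
    by (simp add: x_def mult.assoc u d_e)
  moreover have "star (d * g) * (d * g) = g * star g * star d * d"
  proof -
    have "star (d * g) * (d * g) = star g * (star d * d * g)"
      by (simp add: star_mult mult.assoc)
    also have "star d * d * g = g * (star d * d)" using D by (intro D_commute D_mult)
    also have "star g * (g * (star d * d)) = (star g * g) * (star d * d)" by (simp only: mult.assoc)
    also have "star g * g = g * star g" using D by (intro D_commute)
    finally show ?thesis by (simp add: mult.assoc)
  qed
  ultimately have "d * g = 0" by (metis star_mult_self_eq_0)
  then show ?thesis by (simp add: d_def g_def)
qed

text \<open>
  In the sum of \<open>norm_\<pi>_mult_diff_le\<close> only the diagonal matrix units survive, and they contribute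
  \<open>\<pi> f * \<pi> b\<close>, whatever the level.
\<close>

lemma \<pi>_mult:
  assumes f: "f \<in> A" and b: "b \<in> A"
  shows "\<pi> (f * b) = \<pi> f * \<pi> b"
proof -
  have diag: "(\<Sum>(i, j)\<in>R n. \<pi> (f * e n j i) * \<pi> (e n i j * b)) = \<pi> f * \<pi> b" for n
  proof -
    have "(\<Sum>(i, j)\<in>R n. \<pi> (f * e n j i) * \<pi> (e n i j * b))
        = (\<Sum>(i, j)\<in>(\<lambda>i. (i, i)) ` I n. \<pi> (f * e n j i) * \<pi> (e n i j * b))"
      using offdiagonal_coefficients_disjoint[OF f b]
      by (intro sum.mono_neutral_right finite_R) (auto simp: R_refl R_Field image_iff)
    also have "\<dots> = (\<Sum>i\<in>I n. \<pi> f * e n i i * (e n i i * \<pi> b))"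
      by (subst sum.reindex) (auto simp: inj_on_def \<pi>_D_mult diag_in_D intro!: sum.cong)
    also have "\<dots> = (\<Sum>i\<in>I n. \<pi> f * e n i i * \<pi> b)"
      by (intro sum.cong refl) (simp add: mult.assoc, simp add: mult.assoc[symmetric] diag_mult)
    also have "\<dots> = \<pi> f * (\<Sum>i\<in>I n. e n i i) * \<pi> b"
      by (simp add: sum_distrib_left sum_distrib_right)
    finally show ?thesis by (simp add: sum_diag)
  qed
  have "norm (\<pi> (f * b) - \<pi> f * \<pi> b) \<le> \<epsilon>" if \<epsilon>: "0 < \<epsilon>" for \<epsilon>
  proof -
    have "f \<in> closure (\<Union>n. B n)" using dense_union by simp
    moreover have "0 < \<epsilon> / (norm b + 1)" using \<epsilon> by (simp add: add_nonneg_pos)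
    ultimately obtain n f' where f': "f' \<in> B n" "dist f' f < \<epsilon> / (norm b + 1)"
      unfolding closure_approachable by blast
    have "norm (\<pi> (f * b) - \<pi> f * \<pi> b) \<le> norm (f - f') * norm b"
      using norm_\<pi>_mult_diff_le[OF f'(1), of f b] by (simp add: diag)
    also have "\<dots> \<le> \<epsilon> / (norm b + 1) * (norm b + 1)"
      using f'(2) \<open>0 < \<epsilon> / (norm b + 1)\<close>
      by (intro mult_mono) (auto simp: dist_norm norm_minus_commute)
    also have "\<dots> = \<epsilon>" by (simp add: add_nonneg_eq_0_iff)
    finally show ?thesis .
  qed
  then have "norm (\<pi> (f * b) - \<pi> f * \<pi> b) \<le> 0"
    using field_le_epsilon[of "norm (\<pi> (f * b) - \<pi> f * \<pi> b)" 0] by simp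
  then show ?thesis by simp
qed

section \<open>Closed Lie ideals of triangular subalgebras\<close>

context
  fixes L :: "'a set"
  assumes lie: "lie_ideal A L" and closed_L: "closed L"
begin

lemma csubspace_L: "csubspace L" and L_subset_A: "f \<in> L \<Longrightarrow> f \<in> A"
  and commutator_in_L: "f \<in> L \<Longrightarrow> a \<in> A \<Longrightarrow> f * a - a * f \<in> L"
  using lie by (auto simp: lie_ideal_def)

lemma neg_in_L: "f \<in> L \<Longrightarrow> - f \<in> L"
  using csubspace_scaleR[OF csubspace_L, of f "-1"] by simp

lemma diff_in_L: "f \<in> L \<Longrightarrow> g \<in> L \<Longrightarrow> f - g \<in> L"
  using complex_vs.subspace_add[OF csubspace_L, of f "- g"] neg_in_L by simp

text \<open>
  The commutator of \<open>f\<close> with \<open>p\<close> is the difference of the two off-diagonal corners of \<open>f\<close> relative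
  to \<open>p\<close>, the double commutator is their sum, so \<open>p * f * (1 - p)\<close> lies in the Lie ideal. A commutator
  with \<open>q\<close> then cuts this corner down to \<open>p * f * q\<close>.
\<close>

lemma corner_in_L:
  assumes f: "f \<in> L" and pq: "p \<in> D" "q \<in> D" and "p * p = p" "p * q = 0"
  shows "p * f * q \<in> L"
proof -
  define g where "g = f * p - p * f"
  have g: "g \<in> L" unfolding g_def by (intro commutator_in_L f D_in_A pq)
  have pp: "x * p * p = x * p" "p * (p * x) = p * x" for x
    using assms(4) by (simp_all add: mult.assoc) (simp add: mult.assoc[symmetric])
  \<comment> \<open>Subtracting the double commutator removes \<open>f * p\<close> and leaves a multiple of \<open>p * f * (1 - p)\<close>.\<close>
  have "g - (g * p - p * g) \<in> L"
    by (intro diff_in_L g commutator_in_L D_in_A pq)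
  also have "g - (g * p - p * g) = (-2) *\<^sub>R (p * f - p * f * p)"
    by (simp add: g_def algebra_simps pp assms(4) scaleR_2)
  finally have "(- 1 / 2) *\<^sub>R (-2) *\<^sub>R (p * f - p * f * p) \<in> L"
    by (rule csubspace_scaleR[OF csubspace_L])
  then have h: "p * f - p * f * p \<in> L" by simp
  have qp: "q * p = 0" using D_commute[OF pq] assms(5) by simp
  have "(p * f - p * f * p) * q - q * (p * f - p * f * p) \<in> L"
    by (intro commutator_in_L h D_in_A pq)
  moreover have "(p * f - p * f * p) * q - q * (p * f - p * f * p) = p * f * q"
  proof -
    have "(p * f - p * f * p) * q - q * (p * f - p * f * p)
        = p * f * q - p * f * (p * q) - (q * p) * f + (q * p) * f * p"
      by (simp add: algebra_simps)
    then show ?thesis by (simp add: qp assms(5))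
  qed
  ultimately show ?thesis by simp
qed

lemma diff_pinch_eq: "f - pinch n f = (\<Sum>i\<in>I n. \<Sum>j\<in>I n - {i}. e n i i * f * e n j j)"
proof -
  have "f = (\<Sum>i\<in>I n. e n i i) * f * (\<Sum>j\<in>I n. e n j j)" by (simp add: sum_diag)
  also have "\<dots> = (\<Sum>i\<in>I n. \<Sum>j\<in>I n. e n i i * f * e n j j)"
    unfolding sum_distrib_right[of "\<lambda>i. e n i i" "I n" f] sum_product ..
  also have "\<dots> = (\<Sum>i\<in>I n. e n i i * f * e n i i + (\<Sum>j\<in>I n - {i}. e n i i * f * e n j j))"
    by (intro sum.cong refl sum.remove) auto
  finally show ?thesis by (simp add: pinch_def sum.distrib algebra_simps)
qed

lemma diff_\<pi>_in_L:
  assumes f: "f \<in> L"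
  shows "f - \<pi> f \<in> L"
proof (rule closed_sequentially[OF closed_L])
  show "(\<lambda>n. f - pinch n f) \<longlonglongrightarrow> f - \<pi> f"
    by (intro tendsto_diff tendsto_const pinch_tendsto)
  show "f - pinch n f \<in> L" for n
    unfolding diff_pinch_eq
    by (intro complex_vs.subspace_sum[OF csubspace_L] corner_in_L f diag_in_D) (auto simp: diag_mult)
qed

definition offdiag_part :: "'a set" where
  "offdiag_part = {f \<in> L. \<pi> f = 0}"

text \<open>
  An element killed by \<open>\<pi>\<close> is the limit of the sums of its off-diagonal corners, so continuous linear
  maps into the Lie ideal need only be examined on corners.
\<close>

lemma offdiag_limit:
  assumes f: "f \<in> offdiag_part" and h: "bounded_linear h"
    and corner: "\<And>n i j. \<lbrakk>i \<in> I n; j \<in> I n; i \<noteq> j\<rbrakk> \<Longrightarrow> h (e n i i * f * e n j j) \<in> L"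
  shows "h f \<in> L"
proof (rule closed_sequentially[OF closed_L])
  have "(\<lambda>n. h (f - pinch n f)) \<longlonglongrightarrow> h (f - \<pi> f)"
    by (intro bounded_linear.tendsto[OF h] tendsto_diff tendsto_const pinch_tendsto)
  then show "(\<lambda>n. h (f - pinch n f)) \<longlonglongrightarrow> h f"
    using f by (simp add: offdiag_part_def)
  show "h (f - pinch n f) \<in> L" for n
    unfolding diff_pinch_eq linear_sum[OF bounded_linear.linear[OF h]]
    by (intro complex_vs.subspace_sum[OF csubspace_L] corner) auto
qed

lemma projection_mult_in_L:
  assumes f: "f \<in> offdiag_part" and p: "p \<in> D" "p * p = p"
  shows "p * f \<in> L"
proof (rule offdiag_limit[OF f bounded_linear_mult_right])
  fix n i j assume ij: "i \<in> I n" "j \<in> I n" "i \<noteq> j"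
  have com: "p * e n i i = e n i i * p" using ij p by (intro D_commute diag_in_D)
  have "(p * e n i i) * f * e n j j \<in> L"
  proof (rule corner_in_L)
    show "f \<in> L" using f by (simp add: offdiag_part_def)
    show "p * e n i i * (p * e n i i) = p * e n i i"
      by (metis com mult.assoc p(2) diag_mult[OF ij(1) ij(1)])
  qed (use ij p in \<open>auto simp: diag_mult mult.assoc intro!: D_mult diag_in_D\<close>)
  then show "p * (e n i i * f * e n j j) \<in> L" by (simp add: mult.assoc)
qed

text \<open>
  Let \<open>g = p * f * q\<close> and write \<open>g * a = g * a * (1 - p) + g * a * p\<close>. The first summand is the
  commutator of \<open>g\<close> with \<open>q * a * (1 - p)\<close>. The commutator \<open>h\<close> of \<open>g\<close> with \<open>q * a * p\<close> is
  \<open>g * a * p - q * a * g\<close>, so \<open>p * h\<close> is the second summand and \<open>- q * h\<close> is the corresponding part of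
  \<open>a * g\<close>. That \<open>p * h\<close> and \<open>q * h\<close> stay in the Lie ideal is known only when \<open>\<pi> h = 0\<close>, and
  this is where multiplicativity of \<open>\<pi>\<close> on \<open>\<A>\<close> enters.
\<close>

lemma corner_mult_in_L:
  assumes f: "f \<in> offdiag_part" and a: "a \<in> A"
    and pq: "p \<in> D" "q \<in> D" "p * p = p" "q * q = q" "p * q = 0"
  shows "p * f * q * a \<in> L" and "a * (p * f * q) \<in> L"
proof -
  define g where "g = p * f * q"
  have qp: "q * p = 0" using D_commute[OF pq(1,2)] pq by simp
  have pA: "p \<in> A" "q \<in> A" "1 - p \<in> A" "1 - q \<in> A"
    using pq D_one complex_vs.subspace_diff[OF csubspace_D] by (auto intro: D_in_A)
  have fL: "f \<in> L" using f by (simp add: offdiag_part_def)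
  have gL: "g \<in> L" unfolding g_def by (intro corner_in_L fL pq)
  have gA: "g \<in> A" using gL L_subset_A by blast
  have pg: "p * g = g" "q * g = 0" "g * p = 0" "g * q = g"
    unfolding g_def using pq qp by (simp_all add: mult.assoc) (simp_all add: mult.assoc[symmetric])
  have pg': "p * (g * x) = g * x" "q * (g * x) = 0" "g * (p * x) = 0" "g * (q * x) = g * x" for x
    using pg by (simp_all add: mult.assoc[symmetric])
  define h where "h = g * (q * a * p) - (q * a * p) * g"
  have h_eq: "h = g * a * p - q * a * g" by (simp add: h_def mult.assoc pg pg')
  have hL: "h \<in> L"
    unfolding h_def by (intro commutator_in_L gL A_mult pA a)
  have "\<pi> g = 0"
    using f pq by (simp add: g_def \<pi>_D_mult offdiag_part_def)
  then have "\<pi> h = 0"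
    using \<pi>_mult gA a pA by (simp add: h_eq \<pi>_diff A_mult)
  then have h: "h \<in> offdiag_part" using hL by (simp add: offdiag_part_def)
  have "g * (q * a * (1 - p)) - (q * a * (1 - p)) * g \<in> L"
    by (intro commutator_in_L gL A_mult pA a)
  moreover have "g * (q * a * (1 - p)) - (q * a * (1 - p)) * g = g * a - g * a * p"
    by (simp add: algebra_simps pg pg')
  moreover have "p * h \<in> L" by (intro projection_mult_in_L h pq)
  moreover have "p * h = g * a * p"
  proof -
    have "p * h = (p * g) * a * p - (p * q) * a * g" by (simp add: h_eq algebra_simps)
    then show ?thesis by (simp add: pg pq)
  qed
  ultimately have "g * a - g * a * p + g * a * p \<in> L"
    using complex_vs.subspace_add[OF csubspace_L] by metis
  then show "p * f * q * a \<in> L" by (simp add: g_def)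
  have "g * ((1 - q) * a * p) - ((1 - q) * a * p) * g \<in> L"
    by (intro commutator_in_L gL A_mult pA a)
  moreover have "g * ((1 - q) * a * p) - ((1 - q) * a * p) * g = q * a * g - a * g"
    by (simp add: algebra_simps pg pg')
  moreover have "q * h \<in> L" by (intro projection_mult_in_L h pq)
  moreover have "q * h = - (q * a * g)"
  proof -
    have "q * h = (q * g) * a * p - (q * q) * a * g" by (simp add: h_eq algebra_simps)
    then show ?thesis by (simp add: pg pq)
  qed
  ultimately have "q * a * g - a * g + - (q * a * g) \<in> L"
    using complex_vs.subspace_add[OF csubspace_L] by metis
  then show "a * (p * f * q) \<in> L"
    using neg_in_L[of "- (a * g)"] by (simp add: g_def)
qed

lemma assoc_ideal_offdiag_part: "assoc_ideal A offdiag_part"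
  unfolding assoc_ideal_def
proof (intro conjI ballI)
  show "csubspace offdiag_part"
    using csubspace_L by (auto simp: offdiag_part_def complex_vs.subspace_def \<pi>_add \<pi>_zero \<pi>_scaleC)
  show "offdiag_part \<subseteq> A" using L_subset_A by (auto simp: offdiag_part_def)
  fix f a assume f: "f \<in> offdiag_part" and a: "a \<in> A"
  have fA: "f \<in> A" "\<pi> f = 0" using f L_subset_A by (auto simp: offdiag_part_def)
  have "f * a \<in> L"
    by (rule offdiag_limit[OF f bounded_linear_mult_left])
      (intro corner_mult_in_L f a diag_in_D; simp add: diag_mult)
  then show "f * a \<in> offdiag_part"
    using \<pi>_mult[OF fA(1) a] fA by (simp add: offdiag_part_def)
  have "a * f \<in> L"
    by (rule offdiag_limit[OF f bounded_linear_mult_right])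
      (intro corner_mult_in_L f a diag_in_D; simp add: diag_mult)
  then show "a * f \<in> offdiag_part"
    using \<pi>_mult[OF a fA(1)] fA by (simp add: offdiag_part_def)
qed

lemma lie_ideal_decomposition: "L = {f + k | f k. f \<in> L \<inter> D \<and> k \<in> offdiag_part}"
proof (intro equalityI subsetI)
  fix x assume x: "x \<in> L"
  have "x - (x - \<pi> x) \<in> L" by (intro diff_in_L x diff_\<pi>_in_L)
  then have "\<pi> x \<in> L \<inter> D" by (simp add: \<pi>_in_D)
  moreover have "x - \<pi> x \<in> offdiag_part"
    using diff_\<pi>_in_L[OF x] by (simp add: offdiag_part_def \<pi>_diff \<pi>_D \<pi>_in_D)
  moreover have "x = \<pi> x + (x - \<pi> x)" by simp
  ultimately show "x \<in> {f + k | f k. f \<in> L \<inter> D \<and> k \<in> offdiag_part}" by blast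
qed (auto simp: offdiag_part_def complex_vs.subspace_add[OF csubspace_L])

lemma offdiag_part_Int_D: "offdiag_part \<inter> D = {0}"
  by (auto simp: offdiag_part_def \<pi>_D \<pi>_zero complex_vs.subspace_0[OF csubspace_L]
      complex_vs.subspace_0[OF csubspace_D])

end

end

section \<open>Coordinates on the groupoid\<close>

context
  fixes x :: "'a \<Rightarrow> complex"
  assumes x: "x \<in> gelfand_spectrum D"
begin

lemma character_add: "c \<in> D \<Longrightarrow> d \<in> D \<Longrightarrow> x (c + d) = x c + x d"
  and character_mult: "c \<in> D \<Longrightarrow> d \<in> D \<Longrightarrow> x (c * d) = x c * x d"
  and character_scaleC: "d \<in> D \<Longrightarrow> x (z *\<^sub>C d) = z * x d"
  using x by (simp_all add: gelfand_spectrum_def)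

lemma character_diff:
  assumes "c \<in> D" "d \<in> D"
  shows "x (c - d) = x c - x d"
proof -
  have eq: "c - d = c + (-1) *\<^sub>C d" using scaleC_of_real[of "-1" d] by simp
  show ?thesis
    unfolding eq character_add[OF assms(1) complex_vs.subspace_scale[OF csubspace_D assms(2)]]
      character_scaleC[OF assms(2)] by simp
qed

lemma character_one: "x 1 = 1"
proof -
  obtain d where d: "d \<in> D" "x d \<noteq> 0" using x by (auto simp: gelfand_spectrum_def)
  then show ?thesis using character_mult[OF D_one d(1)] by simp
qed

lemma character_zero: "x 0 = 0"
  using character_diff[OF D_one D_one] by simp

lemma ex_diag_character_eq_1: "\<exists>i\<in>I n. x (e n i i) = 1"
proof (rule ccontr)
  assume none: "\<not> ?thesis"
  have zero: "x (e n i i) = 0" if i: "i \<in> I n" for i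
    using character_mult[OF diag_in_D[OF i] diag_in_D[OF i]] none i by (auto simp: diag_mult)
  have "x (\<Sum>i\<in>J. e n i i) = 0" if "finite J" "J \<subseteq> I n" for J
    using that
  proof (induction J)
    case (insert i J)
    then have "(\<Sum>i\<in>J. e n i i) \<in> D"
      by (intro complex_vs.subspace_sum[OF csubspace_D] diag_in_D) auto
    then show ?case using insert by (simp add: character_add diag_in_D zero)
  qed (simp add: character_zero)
  from this[of "I n"] show False by (simp add: sum_diag character_one)
qed

lemma diagonal_point_in_groupoid: "(x, x) \<in> groupoid R e"
proof -
  obtain i where i: "i \<in> I 0" "x (e 0 i i) = 1" using ex_diag_character_eq_1 by blast
  have D: "e 0 i i \<in> D" using i by (intro diag_in_D)
  have "unit_homeo D (e 0 i i) x = x"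
  proof
    fix d
    show "unit_homeo D (e 0 i i) x d = x d"
      using x D i by (cases "d \<in> D")
        (simp_all add: unit_homeo_def star_diag character_mult D_mult gelfand_spectrum_def extensional_def)
  qed
  then have "(x, x) \<in> unit_graph D (e 0 i i)"
    using x i by (auto simp: unit_graph_def star_diag diag_mult)
  then show ?thesis
    unfolding groupoid_def all_units_def using R_refl[OF i(1)] by blast
qed

end

lemma unit_graphD:
  assumes "(x, y) \<in> unit_graph D (e n i j)" and "(i, j) \<in> R n"
  shows "y \<in> gelfand_spectrum D" "y (e n j j) = 1"
    and "d \<in> D \<Longrightarrow> x d = y (e n j i * d * e n i j)"
  using assms by (auto simp: unit_graph_def unit_homeo_def star_unit unit_mult R_sym)

text \<open>
  The left point of a pair is the conjugate of the right one by a matrix unit, and conjugation is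
  multiplicative on \<open>\<D>\<close> because the final projection of the unit commutes with \<open>\<D>\<close>.
\<close>

lemma groupoid_points_characters:
  assumes "(x, y) \<in> groupoid R e"
  shows "x \<in> gelfand_spectrum D" "y \<in> gelfand_spectrum D"
proof -
  from assms obtain n i j where ij: "(i, j) \<in> R n" and g: "(x, y) \<in> unit_graph D (e n i j)"
    by (auto simp: groupoid_def all_units_def)
  note y = unit_graphD(1)[OF g ij] and yj = unit_graphD(2)[OF g ij] and x = unit_graphD(3)[OF g ij]
  have conj: "e n j i * d * e n i j \<in> D" if "d \<in> D" for d
    using conj_in_D[OF R_sym[OF ij] that] .
  have ii: "e n i i \<in> D" using ij by (auto intro: diag_in_D simp: R_Field)
  have mult: "x (c * d) = x c * x d" if "c \<in> D" "d \<in> D" for c d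
  proof -
    have "e n j i * c * e n i j * (e n j i * d * e n i j) = e n j i * (c * e n i i * d) * e n i j"
      using ij by (simp add: mult.assoc[symmetric]) (simp add: mult.assoc unit_mult R_sym)
    also have "c * e n i i * d = e n i i * (c * d)"
      using D_commute[OF that(1) ii] by (simp add: mult.assoc)
    also have "e n j i * (e n i i * (c * d)) * e n i j = e n j i * (c * d) * e n i j"
      using ij by (simp add: mult.assoc[symmetric] unit_mult R_sym R_refl R_Field)
    finally show ?thesis
      unfolding x[OF D_mult[OF that]] x[OF that(1)] x[OF that(2)]
        character_mult[OF y conj[OF that(1)] conj[OF that(2)], symmetric]
      by simp
  qed
  have "x 1 = 1"
    using x[OF D_one] yj ij by (simp add: unit_mult R_sym)
  moreover have "x \<in> extensional D"
    using g by (auto simp: unit_graph_def unit_homeo_def)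
  moreover have "x (c + d) = x c + x d" if "c \<in> D" "d \<in> D" for c d
    using that x character_add[OF y conj conj] complex_vs.subspace_add[OF csubspace_D]
    by (simp add: distrib_left distrib_right)
  moreover have "x (z *\<^sub>C d) = z * x d" if "d \<in> D" for z d
    using that x character_scaleC[OF y conj] complex_vs.subspace_scale[OF csubspace_D]
    by (simp add: scaleC_mult_left scaleC_mult_right)
  ultimately show "x \<in> gelfand_spectrum D"
    unfolding gelfand_spectrum_def using mult D_one by force
  show "y \<in> gelfand_spectrum D" by (rule y)
qed

lemma coord_unitE:
  assumes "(x, y) \<in> groupoid R e"
  obtains n i j where "(i, j) \<in> R n" "(x, y) \<in> unit_graph D (e n i j)"
    "\<And>f. coord R e f x y = x (\<pi> (f * e n j i))"
proof -
  let ?P = "\<lambda>u. u \<in> all_units R e \<and> (x, y) \<in> unit_graph D u"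
  have "?P (SOME u. ?P u)"
    using assms by (intro someI_ex[of ?P]) (auto simp: groupoid_def)
  then obtain n i j where ij: "(i, j) \<in> R n" and u: "(SOME u. ?P u) = e n i j"
    and g: "(x, y) \<in> unit_graph D (e n i j)"
    unfolding all_units_def by force
  show thesis
    by (rule that[OF ij g]) (use ij in \<open>simp add: coord_def u star_unit\<close>)
qed

text \<open>
  The definition of \<open>coord\<close> selects some unit whose graph contains \<open>(x,x)\<close>. Such a unit is diagonal:
  \<open>x\<close> takes the value 1 on its initial and final projections, which are
  orthogonal otherwise.
\<close>

lemma coord_diagonal:
  assumes x: "x \<in> gelfand_spectrum D" and d: "d \<in> D"
  shows "coord R e d x x = x d"
proof -
  obtain n i j where ij: "(i, j) \<in> R n" and g: "(x, x) \<in> unit_graph D (e n i j)"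
    and coord: "\<And>f. coord R e f x x = x (\<pi> (f * e n j i))"
    using coord_unitE[OF diagonal_point_in_groupoid[OF x]] by blast
  note xj = unit_graphD(2)[OF g ij] and conj = unit_graphD(3)[OF g ij]
  have I: "i \<in> I n" "j \<in> I n" using ij by (auto simp: R_Field)
  have "x (e n i i) = 1"
    using conj[OF diag_in_D[OF I(1)]] xj ij I by (simp add: unit_mult R_sym R_refl)
  then have "x (e n i i * e n j j) = 1"
    using xj I by (simp add: character_mult[OF x] diag_in_D)
  then have "i = j" using I by (auto simp: diag_mult character_zero[OF x] split: if_splits)
  then show ?thesis
    using coord xj I d by (simp add: \<pi>_D D_mult diag_in_D character_mult[OF x])
qed

text \<open>
  Moving \<open>d\<close> across the adjoint of the matrix unit turns it into its conjugate \<open>c\<close>, and the value of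
  \<open>c\<close> at \<open>x\<close> is the value of \<open>d\<close> at \<open>y\<close>.
\<close>

lemma coord_commutator:
  assumes xy: "(x, y) \<in> groupoid R e" and d: "d \<in> D"
  shows "coord R e (d * f - f * d) x y = (x d - y d) * coord R e f x y"
proof -
  obtain n i j where ij: "(i, j) \<in> R n" and g: "(x, y) \<in> unit_graph D (e n i j)"
    and coord: "\<And>f. coord R e f x y = x (\<pi> (f * e n j i))"
    using coord_unitE[OF xy] by blast
  note x = groupoid_points_characters(1)[OF xy] and y = groupoid_points_characters(2)[OF xy]
  note yj = unit_graphD(2)[OF g ij] and conj = unit_graphD(3)[OF g ij]
  define c where "c = e n i j * d * e n j i"
  have c: "c \<in> D" unfolding c_def by (intro conj_in_D ij d)
  have jj: "e n j j \<in> D" using ij by (auto intro: diag_in_D simp: R_Field)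
  have ji: "e n j i * e n i j = e n j j" "e n j j * e n j i = e n j i"
    using ij by (simp_all add: unit_mult R_sym R_refl R_Field)
  have "e n j i * c = e n j j * d * e n j i"
    by (simp add: c_def ji mult.assoc[symmetric])
  also have "e n j j * d = d * e n j j" by (intro D_commute jj d)
  finally have move: "e n j i * c = d * e n j i" by (simp add: mult.assoc ji)
  have "x c = y (e n j i * c * e n i j)" by (rule conj[OF c])
  also have "e n j i * c * e n i j = d * e n j j" by (simp add: move mult.assoc ji)
  finally have xc: "x c = y d" using yj by (simp add: character_mult[OF y] d jj)
  have "(d * f - f * d) * e n j i = d * (f * e n j i) - (f * e n j i) * c"
    by (simp add: algebra_simps move)
  then have "coord R e (d * f - f * d) x y = x (d * \<pi> (f * e n j i) - \<pi> (f * e n j i) * c)"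
    by (simp only: coord \<pi>_diff \<pi>_D_mult[OF d] \<pi>_D_mult[OF c])
  also have "\<dots> = x d * x (\<pi> (f * e n j i)) - x (\<pi> (f * e n j i)) * x c"
    using d c \<pi>_in_D by (simp only: character_diff[OF x] character_mult[OF x] D_mult)
  also have "\<dots> = (x d - y d) * coord R e f x y"
    by (simp add: coord xc left_diff_distrib)
  finally show ?thesis .
qed

end

theorem theorem3:
  fixes B :: "nat \<Rightarrow> 'a::cstar_algebra set"
    and R :: "nat \<Rightarrow> (nat \<times> nat) set"
    and e :: "nat \<Rightarrow> nat \<Rightarrow> nat \<Rightarrow> 'a"
    and D A L :: "'a set"
    and S :: "(('a \<Rightarrow> complex) \<times> ('a \<Rightarrow> complex)) set"
  assumes "canonical_diagonal B R e"
    and "D = diagonal R e"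
    and "triangular D A" and "closed A"
    and "S = spec R e A - spec R e D"
    and "lie_ideal A L" and "closed L"
  shows "\<exists>F K. L = {f + k | f k. f \<in> F \<and> k \<in> K} \<and>
    assoc_ideal A K \<and> K \<inter> D = {0} \<and>
    csubspace F \<and> F \<subseteq> const_on_rel R e (S - spec R e K)"
proof -
  interpret canonical_diagonal B R e by fact
  have tri: "triangular (diagonal R e) A" using assms(2,3) by simp
  note lie = tri assms(4,6,7)
  let ?K = "{f \<in> L. cond_exp R e f = 0}"
  have K: "offdiag_part L = ?K" by (rule offdiag_part_def[OF lie])
  have "L \<inter> D \<subseteq> const_on_rel R e (S - spec R e ?K)"
  proof
    fix d assume d: "d \<in> L \<inter> D"
    then have dD: "d \<in> diagonal R e" using assms(2) by simp
    have "coord R e d x x = coord R e d y y" if S: "(x, y) \<in> S" and nK: "(x, y) \<notin> spec R e ?K" for x y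
    proof (rule ccontr)
      assume ne: "coord R e d x x \<noteq> coord R e d y y"
      from S have xy: "(x, y) \<in> groupoid R e" and "\<exists>f\<in>A. coord R e f x y \<noteq> 0"
        by (auto simp: assms(5) spec_def)
      then obtain f where f: "f \<in> A" "coord R e f x y \<noteq> 0" by blast
      \<comment> \<open>If \<open>d\<close> separates \<open>x\<close> from \<open>y\<close>, then the commutator of \<open>d\<close> with \<open>f\<close> puts \<open>(x, y)\<close> into
        the spectrum of \<open>?K\<close>.\<close>
      have "d * f - f * d \<in> L"
        using commutator_in_L[OF lie] d f by blast
      moreover have "cond_exp R e (d * f - f * d) = 0"
        using D_commute[OF dD \<pi>_in_D] by (simp add: \<pi>_diff \<pi>_D_mult dD)
      moreover have "coord R e (d * f - f * d) x y \<noteq> 0"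
        using ne f groupoid_points_characters[OF xy] by (simp add: coord_commutator[OF xy dD] coord_diagonal dD)
      ultimately have "(x, y) \<in> spec R e ?K"
        using xy by (auto simp: spec_def)
      then show False using nK by contradiction
    qed
    then show "d \<in> const_on_rel R e (S - spec R e ?K)"
      using dD by (auto simp: const_on_rel_def)
  qed
  moreover have "csubspace (L \<inter> D)"
    using csubspace_L[OF lie] csubspace_D assms(2) by (auto intro: complex_vs.subspace_inter)
  ultimately show ?thesis
    using lie_ideal_decomposition[OF lie] assoc_ideal_offdiag_part[OF lie] offdiag_part_Int_D[OF lie]
    unfolding K assms(2) by blast
qed

end
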